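(* Let $R$ be an uncountable atomic (or noetherian) integral domain with zero characteristic. If every $n\in\mathbb{N}$ ($n\geq 1$) has at most countably many (irreducible) divisors in $R$, then $R$ is submaximal.
   Context: All rings are commutative with $1\neq 0$, and a subring of a ring contains the identity of that ring. A maximal subring of $R$ is a proper subring $S\subsetneq R$ such that there is no subring strictly between $S$ and $R$; $R$ is called submaximal if it has at least one maximal subring. An integral domain is atomic if every nonzero non-unit is a finite product of irreducible elements (not necessarily uniquely). Irreducible divisors are counted up to associates. "(Irreducible) divisors" means that the hypothesis need only be imposed on irreducible divisors. *)

theory Defs
  imports "HOL-Algebra.Algebra" "HOL-Library.Countable_Set"
begin

definition maximal_subring :: "'a set \<Rightarrow> ('a, 'b) ring_scheme \<Rightarrow> bool" where
  "maximal_subring S R \<longleftrightarrow>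
     subring S R \<and> S \<subset> carrier R \<and>
     \<not> (\<exists>T. subring T R \<and> S \<subset> T \<and> T \<subset> carrier R)"

definition submaximal :: "('a, 'b) ring_scheme \<Rightarrow> bool" where
  "submaximal R \<longleftrightarrow> (\<exists>S. maximal_subring S R)"

definition char_zero :: "('a, 'b) ring_scheme \<Rightarrow> bool" where
  "char_zero R \<longleftrightarrow> (\<forall>n::nat. n \<ge> 1 \<longrightarrow> [n] \<cdot>\<^bsub>R\<^esub> \<one>\<^bsub>R\<^esub> \<noteq> \<zero>\<^bsub>R\<^esub>)"

text \<open>As in the library's \<^locale>\<open>factorial_domain\<close>, factorisations are taken in the
  monoid \<^term>\<open>mult_of R\<close> of nonzero elements; its units are the units of \<^term>\<open>R\<close>.\<close>

definition atomic_domain :: "('a, 'b) ring_scheme \<Rightarrow> bool" where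
  "atomic_domain R \<longleftrightarrow>
     domain R \<and>
     (\<forall>a \<in> carrier R. a \<noteq> \<zero>\<^bsub>R\<^esub> \<longrightarrow> a \<notin> Units R \<longrightarrow>
        (\<exists>fs. set fs \<subseteq> carrier (mult_of R) \<and> factors (mult_of R) fs a))"

definition irreducible_divisors :: "('a, 'b) ring_scheme \<Rightarrow> 'a \<Rightarrow> 'a set" where
  "irreducible_divisors R a =
     {p \<in> carrier R. ring_irreducible\<^bsub>R\<^esub> p \<and> p divides\<^bsub>R\<^esub> a}"

text \<open>\<^term>\<open>assocs R p\<close> is the class of associates of \<^term>\<open>p\<close> in \<^term>\<open>R\<close>, so its image
  of \<^term>\<open>irreducible_divisors R a\<close> counts irreducible divisors up to associates.\<close>

definition countably_many_irreducible_divisors :: "('a, 'b) ring_scheme \<Rightarrow> 'a \<Rightarrow> bool" where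
  "countably_many_irreducible_divisors R a \<longleftrightarrow>
     countable (assocs R ` irreducible_divisors R a)"

end

theory Submission
  imports Defs
begin

text \<open>A ring that is generated over a proper subring by one element is submaximal, by Zorn's lemma.
  Hence so is a domain \<open>R\<close> with a unit \<open>u\<close> for which there is a subring \<open>M\<close> with
  \<open>u \<in> M\<close>, \<open>1/u \<notin> M\<close> and \<open>M[1/u] = R\<close>. Such an \<open>M\<close> exists as soon as \<open>u\<close> is a prime element
  of some subring \<open>A\<close> with \<open>\<Inter>n. u\<^sup>n A = 0\<close>: enlarge \<open>A\<close> by transcendental elements until \<open>R\<close> is
  algebraic over it, then take \<open>M \<supseteq> A\<close> maximal with \<open>u M \<inter> A = u A\<close>. In characteristic zero this
  applies to \<open>u = 2\<close>, \<open>A = \<int>\<close> if 2 is a unit, and to \<open>A = \<int>[u]\<close> for every unit \<open>u\<close> that is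
  transcendental over \<open>\<int>\<close>.

  If \<open>R\<close> is not submaximal, its units are therefore algebraic over \<open>\<int>\<close>, so countable in number, and
  the positive integers have only countably many divisors altogether. Thus some \<open>2x - 1\<close> divides no
  positive integer, and a prime ideal \<open>P\<close> containing it avoids the positive integers. But then
  \<open>R/P\<close> has characteristic zero and contains \<open>1/2\<close>, so \<open>R/P\<close>, and with it \<open>R\<close>, is submaximal.\<close>

section \<open>Polynomial values over a subring\<close>

text \<open>The values at \<open>r\<close> of polynomials over \<open>A\<close> of degree at most
  \<open>n\<close>, in Horner form, so that inductions on the degree peel off the constant
  coefficient.\<close>

primrec (in ring) poly_values :: "'a set \<Rightarrow> 'a \<Rightarrow> nat \<Rightarrow> 'a set" where
  "poly_values A r 0 = A"
| "poly_values A r (Suc n) = {a \<oplus> r \<otimes> y | a y. a \<in> A \<and> y \<in> poly_values A r n}"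

definition (in ring) adjoin :: "'a set \<Rightarrow> 'a \<Rightarrow> 'a set" where
  "adjoin A r = (\<Union>n. poly_values A r n)"

definition (in ring) algebraic_elem :: "'a set \<Rightarrow> 'a \<Rightarrow> bool" where
  "algebraic_elem A r \<longleftrightarrow>
     (\<exists>n. \<exists>a\<in>A. \<exists>y\<in>poly_values A r n. a \<noteq> \<zero> \<and> a \<otimes> r [^] Suc n \<oplus> y = \<zero>)"

context domain
begin

lemma poly_values_carrier:
  assumes "subring A R" "r \<in> carrier R"
  shows "y \<in> poly_values A r n \<Longrightarrow> y \<in> carrier R"
  using subringE(1)[OF assms(1)] assms(2)
  by (induction n arbitrary: y) auto

lemma poly_values_smult:
  assumes A: "subring A R" and r: "r \<in> carrier R" and a: "a \<in> A"
  shows "y \<in> poly_values A r n \<Longrightarrow> a \<otimes> y \<in> poly_values A r n"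
proof (induction n arbitrary: y)
  case 0
  then show ?case using subringE(6)[OF A] a by simp
next
  case (Suc n)
  then obtain b z where y: "y = b \<oplus> r \<otimes> z" and b: "b \<in> A" and z: "z \<in> poly_values A r n"
    by auto
  have [simp]: "a \<in> carrier R" "b \<in> carrier R" "z \<in> carrier R"
    using a b subringE(1)[OF A] poly_values_carrier[OF A r z] by auto
  have "a \<otimes> y = a \<otimes> b \<oplus> r \<otimes> (a \<otimes> z)"
    using r y by (simp add: r_distr m_lcomm)
  then show ?case using Suc.IH[OF z] subringE(6)[OF A a b] by auto
qed

lemma poly_values_add:
  assumes A: "subring A R" and r: "r \<in> carrier R"
  shows "y \<in> poly_values A r n \<Longrightarrow> z \<in> poly_values A r n \<Longrightarrow> y \<oplus> z \<in> poly_values A r n"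
proof (induction n arbitrary: y z)
  case 0
  then show ?case using subringE(7)[OF A] by simp
next
  case (Suc n)
  then obtain b y' c z' where y: "y = b \<oplus> r \<otimes> y'" and b: "b \<in> A" and y': "y' \<in> poly_values A r n"
    and z: "z = c \<oplus> r \<otimes> z'" and c: "c \<in> A" and z': "z' \<in> poly_values A r n"
    by auto
  have [simp]: "b \<in> carrier R" "c \<in> carrier R" "y' \<in> carrier R" "z' \<in> carrier R"
    using b c subringE(1)[OF A] poly_values_carrier[OF A r] y' z' by auto
  have "y \<oplus> z = (b \<oplus> c) \<oplus> r \<otimes> (y' \<oplus> z')"
    using r y z by (simp add: r_distr a_ac)
  then show ?case using Suc.IH[OF y' z'] subringE(7)[OF A b c] by auto
qed

lemma poly_values_Suc:
  assumes A: "subring A R" and r: "r \<in> carrier R"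
  shows "y \<in> poly_values A r n \<Longrightarrow> y \<in> poly_values A r (Suc n)"
proof (induction n arbitrary: y)
  case 0
  then have "y = y \<oplus> r \<otimes> \<zero>" using r subringE(1)[OF A] by auto
  then show ?case using 0 subringE(2)[OF A] by auto
next
  case (Suc n)
  then show ?case by fastforce
qed

lemma poly_values_mono:
  assumes A: "subring A R" and r: "r \<in> carrier R" and "m \<le> n"
  shows "y \<in> poly_values A r m \<Longrightarrow> y \<in> poly_values A r n"
  using \<open>m \<le> n\<close> by (induction rule: dec_induct) (simp, metis poly_values_Suc[OF A r])

lemma poly_values_coeff:
  assumes A: "subring A R" and r: "r \<in> carrier R" and "a \<in> A"
  shows "a \<in> poly_values A r n"
  using poly_values_mono[OF A r, of 0 n a] assms(3) by simp

lemma poly_values_times_power: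
  assumes A: "subring A R" and r: "r \<in> carrier R" and y: "y \<in> poly_values A r m"
  shows "r [^] k \<otimes> y \<in> poly_values A r (k + m)"
proof (induction k)
  case 0
  then show ?case using y poly_values_carrier[OF A r y] by simp
next
  case (Suc k)
  have [simp]: "y \<in> carrier R" using poly_values_carrier[OF A r y] .
  have "r [^] Suc k \<otimes> y = \<zero> \<oplus> r \<otimes> (r [^] k \<otimes> y)"
    using r by (simp add: m_ac)
  then show ?case using Suc subringE(2)[OF A] by auto
qed

lemma poly_values_mult:
  assumes A: "subring A R" and r: "r \<in> carrier R" and z: "z \<in> poly_values A r m"
  shows "y \<in> poly_values A r n \<Longrightarrow> y \<otimes> z \<in> poly_values A r (n + m)"
proof (induction n arbitrary: y)
  case 0
  then show ?case using poly_values_smult[OF A r _ z] by simp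
next
  case (Suc n)
  then obtain b y' where y: "y = b \<oplus> r \<otimes> y'" and b: "b \<in> A" and y': "y' \<in> poly_values A r n"
    by auto
  have [simp]: "b \<in> carrier R" "y' \<in> carrier R" "z \<in> carrier R"
    using b subringE(1)[OF A] poly_values_carrier[OF A r] y' z by auto
  have "y \<otimes> z = b \<otimes> z \<oplus> r [^] (1::nat) \<otimes> (y' \<otimes> z)"
    using r y by (simp add: l_distr m_assoc)
  moreover have "b \<otimes> z \<in> poly_values A r (Suc n + m)"
    using poly_values_mono[OF A r _ poly_values_smult[OF A r b z]] le_add2 by blast
  moreover have "r [^] (1::nat) \<otimes> (y' \<otimes> z) \<in> poly_values A r (Suc n + m)"
    using poly_values_times_power[OF A r Suc.IH[OF y'], of 1] by simp
  ultimately show ?case using poly_values_add[OF A r] by metis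
qed

text \<open>Horner form shows only the constant coefficient, while degree reductions and algebraic
  relations work with the top one.\<close>

lemma poly_values_leading:
  assumes A: "subring A R" and r: "r \<in> carrier R"
  shows "y \<in> poly_values A r (Suc n) \<Longrightarrow>
           \<exists>z\<in>poly_values A r n. \<exists>b\<in>A. y = z \<oplus> b \<otimes> r [^] Suc n"
proof (induction n arbitrary: y)
  case 0
  then obtain a b where y: "y = a \<oplus> r \<otimes> b" "a \<in> A" "b \<in> A"
    by auto
  then have "y = a \<oplus> b \<otimes> r [^] Suc 0"
    using r subringE(1)[OF A] by (auto simp: m_comm)
  then show ?case using y by auto
next
  case (Suc n)
  from Suc.prems obtain a y' where y: "y = a \<oplus> r \<otimes> y'" and a: "a \<in> A"
    and y': "y' \<in> poly_values A r (Suc n)"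
    by auto
  obtain z b where z: "z \<in> poly_values A r n" and b: "b \<in> A" and "y' = z \<oplus> b \<otimes> r [^] Suc n"
    using Suc.IH[OF y'] by auto
  moreover have [simp]: "a \<in> carrier R" "b \<in> carrier R" "z \<in> carrier R"
    using a b subringE(1)[OF A] poly_values_carrier[OF A r] z by auto
  ultimately have "y = (a \<oplus> r \<otimes> z) \<oplus> b \<otimes> r [^] Suc (Suc n)"
    using r y by (simp add: r_distr a_assoc m_ac)
  moreover have "a \<oplus> r \<otimes> z \<in> poly_values A r (Suc n)" using a z by auto
  ultimately show ?case using b by blast
qed

text \<open>Each term absorbs its share of the factor:
  \<open>c^n a_i r^i = (c^(n-i) a_i) (c r)^i\<close>. This allows \<open>r\<close> to be replaced by
  \<open>c r\<close> in an algebraic relation.\<close>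

lemma poly_values_scale:
  assumes A: "subring A R" and r: "r \<in> carrier R" and c: "c \<in> A"
  shows "y \<in> poly_values A r n \<Longrightarrow> c [^] n \<otimes> y \<in> poly_values A (c \<otimes> r) n"
proof (induction n arbitrary: y)
  case 0
  then show ?case using subringE(1)[OF A] by auto
next
  case (Suc n)
  then obtain a y' where y: "y = a \<oplus> r \<otimes> y'" and a: "a \<in> A" and y': "y' \<in> poly_values A r n"
    by auto
  have [simp]: "a \<in> carrier R" "c \<in> carrier R" "y' \<in> carrier R"
    using a c subringE(1)[OF A] poly_values_carrier[OF A r] y' by auto
  have "c [^] k \<in> A" for k :: nat
    by (induction k) (use subringE(3,6)[OF A] c in auto)
  then have "c [^] Suc n \<otimes> a \<in> A"
    using a subringE(6)[OF A] by blast
  moreover have "c [^] Suc n \<otimes> y = c [^] Suc n \<otimes> a \<oplus> (c \<otimes> r) \<otimes> (c [^] n \<otimes> y')"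
    using r y by (simp add: r_distr m_ac)
  ultimately show ?case using Suc.IH[OF y'] by auto
qed

lemma adjoin_subring:
  assumes A: "subring A R" and r: "r \<in> carrier R"
  shows "subring (adjoin A r) R"
proof (rule subringI)
  show "adjoin A r \<subseteq> carrier R"
    using poly_values_carrier[OF A r] by (auto simp: adjoin_def)
  show "\<one> \<in> adjoin A r"
    using poly_values_coeff[OF A r] subringE(3)[OF A] by (auto simp: adjoin_def)
  show "\<ominus> y \<in> adjoin A r" if y: "y \<in> adjoin A r" for y
  proof -
    obtain n where n: "y \<in> poly_values A r n" using y unfolding adjoin_def by blast
    have "\<ominus> \<one> \<otimes> y \<in> poly_values A r n"
      using poly_values_smult[OF A r _ n] subringE(3,5)[OF A] by blast
    then show ?thesis
      using poly_values_carrier[OF A r n] by (auto simp: adjoin_def l_minus)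
  qed
  show "y \<otimes> z \<in> adjoin A r" if "y \<in> adjoin A r" "z \<in> adjoin A r" for y z
    using that poly_values_mult[OF A r] unfolding adjoin_def by blast
  show "y \<oplus> z \<in> adjoin A r" if yz: "y \<in> adjoin A r" "z \<in> adjoin A r" for y z
  proof -
    obtain m n where "y \<in> poly_values A r m" "z \<in> poly_values A r n"
      using yz unfolding adjoin_def by blast
    then have "y \<in> poly_values A r (max m n)" "z \<in> poly_values A r (max m n)"
      using poly_values_mono[OF A r] by (meson max.cobounded1 max.cobounded2)+
    then show ?thesis
      using poly_values_add[OF A r] by (auto simp: adjoin_def)
  qed
qed

lemma adjoin_coeff:
  assumes "subring A R" "r \<in> carrier R" "a \<in> A"
  shows "a \<in> adjoin A r"
  using poly_values_coeff[OF assms] by (auto simp: adjoin_def)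

lemma adjoin_generator:
  assumes A: "subring A R" and r: "r \<in> carrier R"
  shows "r \<in> adjoin A r"
proof -
  have "r [^] (1::nat) \<otimes> \<one> \<in> poly_values A r (1 + 0)"
    using poly_values_times_power[OF A r, of \<one> 0 1] subringE(3)[OF A] by simp
  then show ?thesis
    using r unfolding adjoin_def by (metis UN_I UNIV_I nat_pow_eone r_one)
qed

lemma adjoin_cases:
  assumes A: "subring A R" and r: "r \<in> carrier R" and "y \<in> adjoin A r"
  obtains a z where "a \<in> A" "z \<in> adjoin A r" "y = a \<oplus> r \<otimes> z"
proof -
  \<comment> \<open>Raising the bound to \<open>Suc n\<close> makes elements of degree 0 split as
    well.\<close>
  obtain n where "y \<in> poly_values A r (Suc n)"
    using assms(3) poly_values_Suc[OF A r] unfolding adjoin_def by blast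
  then show thesis
    using that unfolding adjoin_def by auto
qed

text \<open>The top coefficient of a vanishing polynomial is zero because \<open>r\<close> is
  transcendental, so the degree drops until only \<open>a\<close> is left.\<close>

lemma nonalgebraic_const:
  assumes A: "subring A R" and r: "r \<in> carrier R" and na: "\<not> algebraic_elem A r"
    and a: "a \<in> A" and y: "y \<in> adjoin A r" and eq: "a \<oplus> r \<otimes> y = \<zero>"
  shows "a = \<zero>"
proof -
  have "y \<in> poly_values A r n \<Longrightarrow> a \<oplus> r \<otimes> y = \<zero> \<Longrightarrow> a = \<zero>" for n y
  proof (induction n arbitrary: y)
    case 0
    then have [simp]: "a \<in> carrier R" "y \<in> carrier R"
      using a subringE(1)[OF A] by auto
    have "y \<otimes> r [^] Suc 0 \<oplus> a = \<zero>"
      using 0 r by (simp add: m_comm a_comm)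
    then have "y = \<zero>"
      using na a 0(1) unfolding algebraic_elem_def by fastforce
    then show ?case using 0(2) r by simp
  next
    case (Suc n)
    obtain z b where z: "z \<in> poly_values A r n" and b: "b \<in> A" and y: "y = z \<oplus> b \<otimes> r [^] Suc n"
      using poly_values_leading[OF A r Suc.prems(1)] by auto
    have [simp]: "a \<in> carrier R" "b \<in> carrier R" "z \<in> carrier R"
      using a b subringE(1)[OF A] poly_values_carrier[OF A r] z by auto
    have "b \<otimes> r [^] Suc (Suc n) \<oplus> (a \<oplus> r \<otimes> z) = a \<oplus> r \<otimes> y"
      using r y by (simp add: r_distr a_ac m_ac)
    moreover have "a \<oplus> r \<otimes> z \<in> poly_values A r (Suc n)" using a z by auto
    ultimately have "b = \<zero>"
      using na b Suc.prems(2) unfolding algebraic_elem_def by metis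
    then have "y = z" using y r by simp
    then show ?case using Suc.IH z Suc.prems(2) by simp
  qed
  then show ?thesis using y eq unfolding adjoin_def by blast
qed

lemma algebraic_member:
  assumes A: "subring A R" and "r \<in> A"
  shows "algebraic_elem A r"
proof -
  have "r \<in> carrier R" using assms subringE(1)[OF A] by blast
  then have "\<one> \<otimes> r [^] Suc 0 \<oplus> \<ominus> r = \<zero>" by (simp add: r_neg)
  moreover have "\<ominus> r \<in> poly_values A r 0" using subringE(5)[OF A] assms(2) by simp
  ultimately show ?thesis
    using subringE(3)[OF A] one_not_zero unfolding algebraic_elem_def by blast
qed

text \<open>A countable ring has countably many coefficient lists, and a nonzero polynomial over a
  domain has finitely many roots.\<close>

lemma countable_algebraic:
  assumes A: "subring A R" and "countable A"
  shows "countable {r \<in> carrier R. algebraic_elem A r}"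
proof -
  \<comment> \<open>The polynomials of the library list the leading coefficient first, and
    \<open>eval\<close> reads its exponent off the length. Hence the exact length
    \<open>Suc n\<close>, with leading zeros allowed in \<open>p\<close>.\<close>
  have ev: "\<exists>p. set p \<subseteq> A \<and> length p = Suc n \<and> y = eval p r"
    if r: "r \<in> carrier R" and "y \<in> poly_values A r n" for r y n
    using that(2)
  proof (induction n arbitrary: y)
    case 0
    then show ?case using subringE(1)[OF A] r by (intro exI[of _ "[y]"]) auto
  next
    case (Suc n)
    obtain z b where z: "z \<in> poly_values A r n" and b: "b \<in> A" and y: "y = z \<oplus> b \<otimes> r [^] Suc n"
      using poly_values_leading[OF A r Suc.prems] by auto
    obtain p where p: "set p \<subseteq> A" "length p = Suc n" "z = eval p r"
      using Suc.IH[OF z] by auto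
    have "b \<in> carrier R" "z \<in> carrier R"
      using b subringE(1)[OF A] poly_values_carrier[OF A r] z by auto
    then have "y = eval (b # p) r"
      using y p r by (simp add: a_comm)
    then show ?case using b p by (intro exI[of _ "b # p"]) auto
  qed
  have "{r \<in> carrier R. algebraic_elem A r} \<subseteq>
          (\<Union>p \<in> lists A \<inter> carrier (poly_ring R). {x. is_root p x})"
  proof
    fix r assume "r \<in> {r \<in> carrier R. algebraic_elem A r}"
    then obtain n a y where r: "r \<in> carrier R" and a: "a \<in> A" "a \<noteq> \<zero>"
      and y: "y \<in> poly_values A r n" and eq: "a \<otimes> r [^] Suc n \<oplus> y = \<zero>"
      unfolding algebraic_elem_def by auto
    obtain p where p: "set p \<subseteq> A" "length p = Suc n" "y = eval p r"
      using ev[OF r y] by auto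
    have "is_root (a # p) r"
      using eq p r by (simp add: is_root_def)
    moreover have "a # p \<in> carrier (poly_ring R)"
      using a p(1) subringE(1)[OF A] by (auto simp: univ_poly_def polynomial_def)
    ultimately show "r \<in> (\<Union>p \<in> lists A \<inter> carrier (poly_ring R). {x. is_root p x})"
      using a p(1) by (intro UN_I[of "a # p"]) auto
  qed
  moreover have "countable (\<Union>p \<in> lists A \<inter> carrier (poly_ring R). {x. is_root p x})"
    using assms(2) finite_number_of_roots
    by (intro countable_UN countable_Int1 countable_lists) (auto intro: countable_finite)
  ultimately show ?thesis by (rule countable_subset)
qed

section \<open>Maximal subrings from a unit\<close>

lemma Union_chain_subring:
  assumes "C \<noteq> {}" and sub: "\<And>S. S \<in> C \<Longrightarrow> subring S R"
    and chain: "\<And>S T. S \<in> C \<Longrightarrow> T \<in> C \<Longrightarrow> S \<subseteq> T \<or> T \<subseteq> S"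
  shows "subring (\<Union>C) R"
proof (rule subringI)
  have two: "\<exists>S\<in>C. x \<in> S \<and> y \<in> S" if "x \<in> \<Union>C" "y \<in> \<Union>C" for x y
    using that chain by blast
  show "\<Union>C \<subseteq> carrier R" using subringE(1)[OF sub] by blast
  show "\<one> \<in> \<Union>C" using subringE(3)[OF sub] \<open>C \<noteq> {}\<close> by blast
  show "\<ominus> x \<in> \<Union>C" if "x \<in> \<Union>C" for x using that subringE(5)[OF sub] by blast
  show "x \<otimes> y \<in> \<Union>C" if "x \<in> \<Union>C" "y \<in> \<Union>C" for x y
    using two[OF that] subringE(6)[OF sub] by blast
  show "x \<oplus> y \<in> \<Union>C" if "x \<in> \<Union>C" "y \<in> \<Union>C" for x y
    using two[OF that] subringE(7)[OF sub] by blast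
qed

text \<open>A subring maximal among those that contain \<open>S\<close> and miss \<open>w\<close> is
  a maximal subring: anything larger contains \<open>w\<close>, so \<open>gen\<close> makes it the
  whole ring.\<close>

lemma submaximal_if_generated:
  assumes S: "subring S R" and w: "w \<in> carrier R" "w \<notin> S"
    and gen: "\<And>T. subring T R \<Longrightarrow> S \<subseteq> T \<Longrightarrow> w \<in> T \<Longrightarrow> T = carrier R"
  shows "submaximal R"
proof -
  let ?F = "{T. subring T R \<and> S \<subseteq> T \<and> w \<notin> T}"
  have "\<exists>M\<in>?F. \<forall>Y\<in>?F. M \<subseteq> Y \<longrightarrow> Y = M"
  proof (rule subset_Zorn_nonempty)
    show "?F \<noteq> {}" using S w by blast
    fix C assume C: "C \<noteq> {}" "subset.chain ?F C"
    then have "subring (\<Union>C) R"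
      by (intro Union_chain_subring) (auto simp: subset_chain_def)
    then show "\<Union>C \<in> ?F" using C by (auto simp: subset_chain_def)
  qed
  then obtain M where M: "subring M R" "S \<subseteq> M" "w \<notin> M"
    and max: "\<And>Y. subring Y R \<Longrightarrow> S \<subseteq> Y \<Longrightarrow> w \<notin> Y \<Longrightarrow> M \<subseteq> Y \<Longrightarrow> Y = M"
    by auto
  have "maximal_subring M R"
    unfolding maximal_subring_def
  proof (intro conjI notI)
    show "subring M R" by fact
    show "M \<subset> carrier R" using subringE(1)[OF M(1)] M(3) w by blast
    assume "\<exists>T. subring T R \<and> M \<subset> T \<and> T \<subset> carrier R"
    then obtain T where T: "subring T R" "M \<subset> T" "T \<subset> carrier R" by auto
    then have "w \<in> T" using max[of T] M(2) by blast
    then show False using gen[of T] T M(2) by blast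
  qed
  then show ?thesis unfolding submaximal_def by blast
qed

text \<open>By \<open>pow\<close> the ring is the localization of \<open>S\<close> at the powers of
  \<open>u\<close>, so \<open>inv u\<close> generates it over \<open>S\<close>.\<close>

lemma submaximal_if_power_absorbing:
  assumes S: "subring S R" and u: "u \<in> Units R" "u \<in> S" and inv: "inv u \<notin> S"
    and pow: "\<And>r. r \<in> carrier R \<Longrightarrow> \<exists>n::nat. u [^] n \<otimes> r \<in> S"
  shows "submaximal R"
proof (rule submaximal_if_generated[OF S])
  show "inv u \<in> carrier R" "inv u \<notin> S" using u inv by auto
  fix T assume T: "subring T R" "S \<subseteq> T" "inv u \<in> T"
  have "r \<in> T" if r: "r \<in> carrier R" for r
  proof -
    obtain n :: nat where "u [^] n \<otimes> r \<in> S" using pow[OF r] by auto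
    then have "u [^] n \<otimes> r \<in> T" using T by auto
    then show ?thesis
    proof (induction n)
      case 0
      then show ?case using r by simp
    next
      case (Suc n)
      have "inv u \<otimes> (u [^] Suc n \<otimes> r) = (inv u \<otimes> u) \<otimes> (u [^] n \<otimes> r)"
        using u r by (simp add: m_ac Units_closed del: Units_l_inv Units_r_inv)
      also have "\<dots> = u [^] n \<otimes> r" using u r by (simp add: Units_closed)
      finally show ?case using Suc subringE(6)[OF T(1) T(3)] by metis
    qed
  qed
  then show "T = carrier R" using subringE(1)[OF T(1)] by blast
qed

end

section \<open>Separated prime elements of subrings\<close>

definition (in ring) multiples :: "'a set \<Rightarrow> 'a \<Rightarrow> 'a set" where
  "multiples A c = {c \<otimes> x | x. x \<in> A}"

text \<open>\<open>u\<close> generates a prime ideal of \<open>A\<close>, and \<open>A\<close> is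
  separated in the \<open>u\<close>-adic topology, so that an exact power of \<open>u\<close>
  divides each nonzero element. The case \<open>u = \<zero>\<close> is not excluded, hence the
  separate hypotheses \<open>u \<noteq> \<zero>\<close> below.\<close>

definition (in ring) separated_prime :: "'a \<Rightarrow> 'a set \<Rightarrow> bool" where
  "separated_prime u A \<longleftrightarrow> subring A R \<and> u \<in> A \<and> \<one> \<notin> multiples A u \<and>
     (\<forall>a\<in>A. \<forall>b\<in>A. a \<otimes> b \<in> multiples A u \<longrightarrow> a \<in> multiples A u \<or> b \<in> multiples A u) \<and>
     (\<forall>a\<in>A. (\<forall>n::nat. a \<in> multiples A (u [^] n)) \<longrightarrow> a = \<zero>)"

context domain
begin

lemma separated_primeD:
  assumes "separated_prime u A"
  shows "subring A R" "u \<in> A" "\<one> \<notin> multiples A u"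
    "\<And>a b. a \<in> A \<Longrightarrow> b \<in> A \<Longrightarrow> a \<otimes> b \<in> multiples A u \<Longrightarrow>
       a \<in> multiples A u \<or> b \<in> multiples A u"
    "\<And>a. a \<in> A \<Longrightarrow> (\<And>n::nat. a \<in> multiples A (u [^] n)) \<Longrightarrow> a = \<zero>"
  using assms unfolding separated_prime_def by auto

text \<open>\<open>adjoin A r\<close> is a polynomial ring over \<open>A\<close>: Gauss's argument
  keeps \<open>u\<close> prime, and divisibility by powers of \<open>u\<close> is decided
  coefficient by coefficient. The second claim says that dividing an element of \<open>A\<close> by
  \<open>u\<close> does not lead out of \<open>A\<close>; the order used for Zorn's lemma below asks
  for it.\<close>

lemma separated_prime_adjoin:
  assumes good: "separated_prime u A" and u0: "u \<noteq> \<zero>"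
    and r: "r \<in> carrier R" and na: "\<not> algebraic_elem A r"
  shows "separated_prime u (adjoin A r)"
    and "\<And>a w. a \<in> A \<Longrightarrow> w \<in> adjoin A r \<Longrightarrow> a = u \<otimes> w \<Longrightarrow> w \<in> A"
proof -
  note A = separated_primeD(1)[OF good] and uA = separated_primeD(2)[OF good]
  let ?B = "adjoin A r"
  have B: "subring ?B R" using adjoin_subring[OF A r] .
  have ur[simp]: "u \<in> carrier R" "r \<in> carrier R" using uA subringE(1)[OF A] r by auto
  have cA[simp]: "a \<in> A \<Longrightarrow> a \<in> carrier R" for a using subringE(1)[OF A] by blast
  have cB[simp]: "a \<in> ?B \<Longrightarrow> a \<in> carrier R" for a using subringE(1)[OF B] by blast
  have AB: "A \<subseteq> ?B" using adjoin_coeff[OF A r] by blast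
  have r0: "r \<noteq> \<zero>" using na algebraic_member[OF A] subringE(2)[OF A] by auto
  \<comment> \<open>The difference of the two sides vanishes, so \<open>nonalgebraic_const\<close>
    kills its constant term, and then \<open>r\<close> cancels.\<close>
  have uniq: "a = b \<and> y = z"
    if "a \<in> A" "b \<in> A" "y \<in> ?B" "z \<in> ?B" and eq: "a \<oplus> r \<otimes> y = b \<oplus> r \<otimes> z" for a b y z
  proof -
    have car[simp]: "a \<in> carrier R" "b \<in> carrier R" "y \<in> carrier R" "z \<in> carrier R"
      using that by auto
    have "(a \<ominus> b) \<oplus> r \<otimes> (y \<ominus> z) = (a \<oplus> r \<otimes> y) \<ominus> (b \<oplus> r \<otimes> z)"
      using car ur by algebra
    also have "\<dots> = \<zero>" using eq by (simp add: minus_eq r_neg)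
    finally have *: "(a \<ominus> b) \<oplus> r \<otimes> (y \<ominus> z) = \<zero>" .
    have "a \<ominus> b \<in> A" "y \<ominus> z \<in> ?B"
      using that subringE(5,7)[OF A] subringE(5,7)[OF B] by (auto simp: minus_eq)
    then have ab: "a \<ominus> b = \<zero>" using nonalgebraic_const[OF A r na] * by blast
    then have "a = b" by simp
    moreover have "y = z" using eq r0 by (simp add: \<open>a = b\<close> m_lcancel)
    ultimately show ?thesis by simp
  qed
  show pure: "w \<in> A" if aw: "a \<in> A" "w \<in> ?B" "a = u \<otimes> w" for a w
  proof -
    obtain c z where w: "c \<in> A" "z \<in> ?B" "w = c \<oplus> r \<otimes> z"
      using adjoin_cases[OF A r aw(2)] .
    then have "a \<oplus> r \<otimes> \<zero> = u \<otimes> c \<oplus> r \<otimes> (u \<otimes> z)"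
      using aw by (simp add: r_distr m_lcomm)
    moreover have "a \<in> A" "u \<otimes> c \<in> A" "\<zero> \<in> ?B" "u \<otimes> z \<in> ?B"
      using aw w uA AB subringE(6)[OF A] subringE(2,6)[OF B] by auto
    ultimately have "u \<otimes> z = \<zero>" using uniq by metis
    then have "z = \<zero>" using u0 w integral[of u z] by auto
    then show ?thesis using w by simp
  qed
  \<comment> \<open>Induction on the sum of the degree bounds: the constant terms multiply into
    \<open>u A\<close>, so \<open>u\<close> divides one of them. That term is removed, and
    \<open>r\<close> is cancelled from what remains.\<close>
  have prime: "a \<in> multiples ?B u \<or> b \<in> multiples ?B u"
    if a: "a \<in> poly_values A r m" and b: "b \<in> poly_values A r n" and ab: "a \<otimes> b \<in> multiples ?B u" for a b m n
    using that
  proof (induction "m + n" arbitrary: a b m n rule: less_induct)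
    case less
    have inB: "a \<in> ?B" "b \<in> ?B" using less.prems by (auto simp: adjoin_def)
    obtain h where h: "h \<in> ?B" "a \<otimes> b = u \<otimes> h"
      using less.prems(3) by (auto simp: multiples_def)
    \<comment> \<open>A constant gets the tail \<open>\<zero>\<close>, which is a multiple of
      \<open>u\<close> anyway. The induction hypothesis serves only \<open>m = Suc m'\<close>, where
      the bound really drops.\<close>
    obtain a0 a' where a0: "a0 \<in> A" "a' \<in> ?B" "a = a0 \<oplus> r \<otimes> a'"
      and am: "m = 0 \<and> a' = \<zero> \<or> (\<exists>m'. m = Suc m' \<and> a' \<in> poly_values A r m')"
    proof (cases m)
      case 0
      then show thesis using that[of a \<zero>] less.prems(1) subringE(2)[OF B] by auto
    next
      case (Suc m')
      then show thesis using that less.prems(1) by (auto simp: adjoin_def)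
    qed
    obtain b0 b' where b0: "b0 \<in> A" "b' \<in> ?B" "b = b0 \<oplus> r \<otimes> b'"
      and bn: "n = 0 \<and> b' = \<zero> \<or> (\<exists>n'. n = Suc n' \<and> b' \<in> poly_values A r n')"
    proof (cases n)
      case 0
      then show thesis using that[of b \<zero>] less.prems(2) subringE(2)[OF B] by auto
    next
      case (Suc n')
      then show thesis using that less.prems(2) by (auto simp: adjoin_def)
    qed
    have ab0: "a0 \<otimes> b0 \<in> multiples A u"
    proof -
      obtain h0 h' where h0: "h0 \<in> A" "h' \<in> ?B" "h = h0 \<oplus> r \<otimes> h'"
        using adjoin_cases[OF A r h(1)] .
      have car[simp]: "a0 \<in> carrier R" "b0 \<in> carrier R" "a' \<in> carrier R" "b' \<in> carrier R"
        "h0 \<in> carrier R" "h' \<in> carrier R"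
        using a0 b0 h0 by auto
      have "a \<otimes> b = a0 \<otimes> b0 \<oplus> r \<otimes> (a0 \<otimes> b' \<oplus> a' \<otimes> b)"
        unfolding a0(3) b0(3) using car ur by algebra
      moreover have "u \<otimes> h = u \<otimes> h0 \<oplus> r \<otimes> (u \<otimes> h')"
        unfolding h0(3) using car ur by algebra
      moreover have "a0 \<otimes> b' \<oplus> a' \<otimes> b \<in> ?B" "u \<otimes> h' \<in> ?B" "a0 \<otimes> b0 \<in> A" "u \<otimes> h0 \<in> A"
        using a0(1,2) b0(1,2) h0(1,2) inB uA AB subringE(6)[OF A] subringE(6,7)[OF B] by auto
      ultimately have "a0 \<otimes> b0 = u \<otimes> h0" using uniq h(2) by metis
      then show ?thesis using h0 by (auto simp: multiples_def)
    qed
    \<comment> \<open>Either factor may play the role of \<open>x\<close>. With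
      \<open>x0 = u c\<close>, subtracting \<open>u c y\<close> from both sides and comparing tails
      gives \<open>x' y = u e\<close>.\<close>
    have step: "x' \<otimes> y \<in> multiples ?B u" "x' \<in> multiples ?B u \<Longrightarrow> x \<in> multiples ?B u"
      if x: "x = x0 \<oplus> r \<otimes> x'" "x0 \<in> multiples A u" "x' \<in> ?B" and y: "y \<in> ?B"
        and xy: "x \<otimes> y = u \<otimes> h" for x x0 x' y
    proof -
      obtain c where c: "c \<in> A" "x0 = u \<otimes> c" using x(2) by (auto simp: multiples_def)
      have "h \<ominus> c \<otimes> y \<in> ?B"
        using h(1) c y AB subringE(5,6,7)[OF B] unfolding minus_eq by blast
      then obtain e0 e where e: "e0 \<in> A" "e \<in> ?B" "h \<ominus> c \<otimes> y = e0 \<oplus> r \<otimes> e"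
        using adjoin_cases[OF A r] by metis
      have car[simp]: "x' \<in> carrier R" "y \<in> carrier R" "h \<in> carrier R" "c \<in> carrier R"
        "e0 \<in> carrier R" "e \<in> carrier R"
        using x y h c e by auto
      have "\<zero> \<oplus> r \<otimes> (x' \<otimes> y) = x \<otimes> y \<ominus> u \<otimes> c \<otimes> y"
        unfolding x(1) c(2) using car ur by algebra
      also have "\<dots> = u \<otimes> (h \<ominus> c \<otimes> y)" unfolding xy using car ur by algebra
      also have "\<dots> = u \<otimes> e0 \<oplus> r \<otimes> (u \<otimes> e)" unfolding e(3) using car ur by algebra
      finally have "\<zero> \<oplus> r \<otimes> (x' \<otimes> y) = u \<otimes> e0 \<oplus> r \<otimes> (u \<otimes> e)" .
      moreover have "\<zero> \<in> A" "u \<otimes> e0 \<in> A" "x' \<otimes> y \<in> ?B" "u \<otimes> e \<in> ?B"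
        using x(3) y e(1,2) uA AB subringE(2,6)[OF A] subringE(6)[OF B] by auto
      ultimately have "x' \<otimes> y = u \<otimes> e" using uniq by metis
      then show "x' \<otimes> y \<in> multiples ?B u" using e by (auto simp: multiples_def)
      assume "x' \<in> multiples ?B u"
      then obtain d where d: "d \<in> ?B" "x' = u \<otimes> d" by (auto simp: multiples_def)
      then have dc: "d \<in> carrier R" by simp
      have "x = u \<otimes> (c \<oplus> r \<otimes> d)" unfolding x(1) c(2) d(2) using car ur dc by algebra
      moreover have "c \<oplus> r \<otimes> d \<in> ?B"
        using c d AB adjoin_generator[OF A r] subringE(6,7)[OF B] by blast
      ultimately show "x \<in> multiples ?B u" by (auto simp: multiples_def)
    qed
    have zero: "\<zero> \<in> multiples ?B u"
      using subringE(2)[OF B] unfolding multiples_def by force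
    consider "a0 \<in> multiples A u" | "b0 \<in> multiples A u"
      using separated_primeD(4)[OF good a0(1) b0(1) ab0] by blast
    then show ?case
    proof cases
      case 1
      note st = step[OF a0(3) 1 a0(2) inB(2) h(2)]
      show ?thesis
        using am
      proof
        assume "m = 0 \<and> a' = \<zero>"
        then show ?thesis using st zero by simp
      next
        assume "\<exists>m'. m = Suc m' \<and> a' \<in> poly_values A r m'"
        then show ?thesis using less.hyps less.prems(2) st by force
      qed
    next
      case 2
      have ba: "b \<otimes> a = u \<otimes> h" using h inB by (simp add: m_comm)
      note st = step[OF b0(3) 2 b0(2) inB(1) ba]
      show ?thesis
        using bn
      proof
        assume "n = 0 \<and> b' = \<zero>"
        then show ?thesis using st zero by simp
      next
        assume "\<exists>n'. n = Suc n' \<and> b' \<in> poly_values A r n'"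
        moreover have "a \<otimes> b' \<in> multiples ?B u" using st(1) inB b0(2) by (simp add: m_comm)
        ultimately show ?thesis using less.hyps less.prems(1) st by force
      qed
    qed
  qed
  have upow: "u [^] n \<in> A" for n :: nat
    by (induction n) (use subringE(3,6)[OF A] uA in auto)
  \<comment> \<open>By \<open>uniq\<close>, divisibility by \<open>u^k\<close> passes to the
    constant term and to the tail, so separatedness of \<open>A\<close> kills one coefficient after
    another.\<close>
  have sep: "y = \<zero>"
    if "y \<in> poly_values A r n" "\<And>k::nat. y \<in> multiples ?B (u [^] k)" for y n
    using that
  proof (induction n arbitrary: y)
    case 0
    have "y \<in> multiples A (u [^] k)" for k :: nat
    proof -
      obtain w where w: "w \<in> ?B" "y = u [^] k \<otimes> w" using 0(2)[of k] by (auto simp: multiples_def)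
      obtain c z where c: "c \<in> A" "z \<in> ?B" "w = c \<oplus> r \<otimes> z" using adjoin_cases[OF A r w(1)] .
      have [simp]: "y \<in> carrier R" using 0 by auto
      have "y \<oplus> r \<otimes> \<zero> = u [^] k \<otimes> c \<oplus> r \<otimes> (u [^] k \<otimes> z)"
        using w c by (simp add: r_distr m_lcomm)
      moreover have "y \<in> A" "u [^] k \<otimes> c \<in> A" "\<zero> \<in> ?B" "u [^] k \<otimes> z \<in> ?B"
        using 0(1) c(1,2) upow upow[THEN subsetD[OF AB]] subringE(6)[OF A] subringE(2,6)[OF B] by auto
      ultimately have "y = u [^] k \<otimes> c" using uniq by metis
      then show ?thesis using c by (auto simp: multiples_def)
    qed
    then show ?case using separated_primeD(5)[OF good] 0(1) by simp
  next
    case (Suc n)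
    then obtain a y' where y: "a \<in> A" "y' \<in> poly_values A r n" "y = a \<oplus> r \<otimes> y'" by auto
    have y'B: "y' \<in> ?B" using y by (auto simp: adjoin_def)
    have "a \<in> multiples A (u [^] k) \<and> y' \<in> multiples ?B (u [^] k)" for k :: nat
    proof -
      obtain w where w: "w \<in> ?B" "y = u [^] k \<otimes> w"
        using Suc.prems(2)[of k] by (auto simp: multiples_def)
      obtain c z where c: "c \<in> A" "z \<in> ?B" "w = c \<oplus> r \<otimes> z" using adjoin_cases[OF A r w(1)] .
      have "a \<oplus> r \<otimes> y' = u [^] k \<otimes> c \<oplus> r \<otimes> (u [^] k \<otimes> z)"
        using w c y by (simp add: r_distr m_lcomm)
      moreover have "u [^] k \<otimes> c \<in> A" "u [^] k \<otimes> z \<in> ?B"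
        using c(1,2) upow upow[THEN subsetD[OF AB]] subringE(6)[OF A] subringE(6)[OF B] by auto
      ultimately have "a = u [^] k \<otimes> c \<and> y' = u [^] k \<otimes> z" using uniq y y'B by metis
      then show ?thesis using c by (auto simp: multiples_def)
    qed
    then have "a = \<zero>" "y' = \<zero>"
      using separated_primeD(5)[OF good y(1)] Suc.IH[OF y(2)] by auto
    then show ?case using y by simp
  qed
  have "\<one> \<notin> multiples ?B u"
  proof
    assume "\<one> \<in> multiples ?B u"
    then obtain w where "w \<in> ?B" "\<one> = u \<otimes> w" by (auto simp: multiples_def)
    then have "\<one> \<in> multiples A u"
      using pure[of \<one> w] subringE(3)[OF A] by (auto simp: multiples_def)
    then show False using separated_primeD(3)[OF good] by simp
  qed
  then show "separated_prime u ?B"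
    unfolding separated_prime_def
    using B uA AB prime sep by (auto simp: adjoin_def)
qed


text \<open>Chevalley's argument for valuation rings, with \<open>u M \<inter> A = u A\<close> in place of a maximal ideal:
  the two relations, of degrees \<open>e\<close> in \<open>s\<close> and \<open>d\<close> in \<open>1/s\<close>, can be used to lower
  the larger of the two degrees.\<close>

lemma no_opposite_relations:
  assumes good: "separated_prime u A"
    and M: "subring M R" and AM: "A \<subseteq> M" and pure: "multiples M u \<inter> A \<subseteq> multiples A u"
    and s: "s \<in> carrier R" "s \<noteq> \<zero>"
  shows "g \<in> A - multiples A u \<Longrightarrow> h \<in> A - multiples A u \<Longrightarrow>
    y \<in> poly_values M s e \<Longrightarrow> z \<in> poly_values M s d \<Longrightarrow>
    g = u \<otimes> y \<Longrightarrow> h \<otimes> s [^] d = u \<otimes> z \<Longrightarrow> False"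
proof (induction "e + d" arbitrary: g h y z e d rule: less_induct)
  case less
  note A = separated_primeD(1)[OF good] and uA = separated_primeD(2)[OF good]
  note P = poly_values_carrier[OF M s(1)]
  have cM: "a \<in> M \<Longrightarrow> a \<in> carrier R" for a using subringE(1)[OF M] by blast
  have base: False if "f \<in> A - multiples A u" "x \<in> M" "f = u \<otimes> x" for f x
    using that pure by (auto simp: multiples_def)
  \<comment> \<open>Lowering a degree replaces the coefficient of the changed relation by
    \<open>g \<otimes> h\<close>; primality of \<open>u\<close> keeps it outside
    \<open>u A\<close>.\<close>
  have gh: "g \<otimes> h \<in> A - multiples A u"
    using less.prems(1,2) separated_primeD(4)[OF good] subringE(6)[OF A] by blast
  have gM: "g \<in> M" "h \<in> M" "u \<in> M" using less.prems(1,2) uA AM by auto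
  note gc = gM[THEN cM]
  show False
  proof (cases "e = 0 \<or> d = 0")
    case True
    then show False
    proof
      assume "e = 0"
      then show False using base[of g y] less.prems by simp
    next
      assume "d = 0"
      then show False using base[of h z] less.prems gc by simp
    qed
  next
    case False
    then obtain e' d' where ed: "e = Suc e'" "d = Suc d'" by (meson not0_implies_Suc)
    show False
    proof (cases "d \<le> e")
      case True
      then obtain k where k: "e' = k + d'" using ed by (metis Suc_le_mono le_Suc_ex add.commute)
      obtain y' b where y': "y' \<in> poly_values M s e'" and b: "b \<in> M"
        and y: "y = y' \<oplus> b \<otimes> s [^] Suc e'"
        using poly_values_leading[OF M s(1)] less.prems(3) ed by blast
      obtain z' c where z': "z' \<in> poly_values M s d'" and c: "c \<in> M"
        and z: "z = z' \<oplus> c \<otimes> s [^] Suc d'"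
        using poly_values_leading[OF M s(1)] less.prems(4) ed by blast
      define p where "p = s [^] k"
      define q where "q = s [^] Suc d'"
      have car: "y' \<in> carrier R" "b \<in> carrier R" "z' \<in> carrier R" "c \<in> carrier R"
        "p \<in> carrier R" "q \<in> carrier R" "g \<in> carrier R" "h \<in> carrier R" "u \<in> carrier R"
        using P y' z' b c cM s gc by (auto simp: p_def q_def)
      have "s [^] Suc e' = p \<otimes> q"
        unfolding k p_def q_def using s by (simp add: nat_pow_mult[symmetric] m_assoc)
      then have g: "g = u \<otimes> (y' \<oplus> b \<otimes> (p \<otimes> q))" using less.prems(5) y by simp
      have h: "h \<otimes> q = u \<otimes> (z' \<oplus> c \<otimes> q)" using less.prems(6) z ed by (simp add: q_def)
      \<comment> \<open>Moving the top term of \<open>z\<close> to the left gives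
        \<open>f s^d = u z'\<close>. As \<open>c\<close> is only known to lie in \<open>M\<close>,
        \<open>f\<close> may lie outside \<open>A\<close> and cannot replace \<open>h\<close>; it
        serves to remove the top term of \<open>y\<close> in
        \<open>g h = u c g + f g\<close>.\<close>
      define f where "f = h \<ominus> u \<otimes> c"
      have f: "f \<in> carrier R" "f \<in> M"
        using car subringE(5,6,7)[OF M] c gM unfolding f_def minus_eq by auto
      have "f \<otimes> q = h \<otimes> q \<ominus> u \<otimes> c \<otimes> q" unfolding f_def using car by algebra
      also have "\<dots> = u \<otimes> z'" unfolding h using car by algebra
      finally have fq: "f \<otimes> q = u \<otimes> z'" .
      define w where "w = c \<otimes> g \<oplus> (f \<otimes> y' \<oplus> (b \<otimes> u) \<otimes> (p \<otimes> z'))"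
      have "g \<otimes> h = u \<otimes> (c \<otimes> g) \<oplus> f \<otimes> g" unfolding f_def using car by algebra
      also have "f \<otimes> g = u \<otimes> (f \<otimes> y' \<oplus> b \<otimes> p \<otimes> (f \<otimes> q))"
        unfolding g using car f(1) by algebra
      also have "u \<otimes> (c \<otimes> g) \<oplus> u \<otimes> (f \<otimes> y' \<oplus> b \<otimes> p \<otimes> (f \<otimes> q)) = u \<otimes> w"
        unfolding fq w_def using car f(1) by algebra
      finally have "g \<otimes> h = u \<otimes> w" .
      moreover have "w \<in> poly_values M s e'"
        unfolding w_def
      proof (intro poly_values_add[OF M s(1)])
        show "c \<otimes> g \<in> poly_values M s e'"
          using poly_values_coeff[OF M s(1)] subringE(6)[OF M] c gM by blast
        show "f \<otimes> y' \<in> poly_values M s e'"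
          using poly_values_smult[OF M s(1) f(2) y'] .
        have "p \<otimes> z' \<in> poly_values M s e'"
          unfolding k p_def by (rule poly_values_times_power[OF M s(1) z'])
        then show "(b \<otimes> u) \<otimes> (p \<otimes> z') \<in> poly_values M s e'"
          using poly_values_smult[OF M s(1)] subringE(6)[OF M] b gM by blast
      qed
      ultimately show False
        using less.hyps[of e' d "g \<otimes> h" h w z] less.prems gh ed by auto
    next
      case False
      then have le: "e' \<le> d'" using ed by simp
      \<comment> \<open>Mirror image under exchanging \<open>s\<close> and \<open>1/s\<close>: here
        the constant terms are split off.\<close>
      obtain a y' where y': "y' \<in> poly_values M s e'" and a: "a \<in> M" and y: "y = a \<oplus> s \<otimes> y'"
        using less.prems(3) ed by auto
      obtain b z' where z': "z' \<in> poly_values M s d'" and b: "b \<in> M" and z: "z = b \<oplus> s \<otimes> z'"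
        using less.prems(4) ed by auto
      define p where "p = s [^] d'"
      have car: "y' \<in> carrier R" "b \<in> carrier R" "z' \<in> carrier R" "a \<in> carrier R" "s \<in> carrier R"
        "p \<in> carrier R" "g \<in> carrier R" "h \<in> carrier R" "u \<in> carrier R"
        using P y' z' b a cM s gc by (auto simp: p_def)
      have g: "g = u \<otimes> (a \<oplus> s \<otimes> y')" using less.prems(5) y by simp
      have h: "h \<otimes> (p \<otimes> s) = u \<otimes> (b \<oplus> s \<otimes> z')"
        using less.prems(6) z ed by (simp add: p_def)
      \<comment> \<open>As \<open>f = u s y'\<close>, every term in the expansion of
        \<open>g h s^d\<close> as a multiple of \<open>u\<close> carries a factor \<open>s\<close>;
        cancelling it lowers \<open>d\<close> to \<open>d'\<close>.\<close>
      define f where "f = g \<ominus> u \<otimes> a"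
      have f: "f \<in> carrier R" "f \<in> M"
        using car subringE(5,6,7)[OF M] a gM unfolding f_def minus_eq by auto
      have fs: "f = u \<otimes> s \<otimes> y'" unfolding f_def g using car by algebra
      define w where "w = (a \<otimes> h) \<otimes> p \<oplus> (f \<otimes> z' \<oplus> (u \<otimes> b) \<otimes> y')"
      have wc: "w \<in> carrier R" using car f by (simp add: w_def)
      have gf: "g = f \<oplus> u \<otimes> a" unfolding f_def using car by algebra
      have "s \<otimes> (g \<otimes> h \<otimes> p) = u \<otimes> a \<otimes> h \<otimes> p \<otimes> s \<oplus> f \<otimes> (h \<otimes> (p \<otimes> s))"
        unfolding gf using car f(1) by algebra
      also have "\<dots> = u \<otimes> a \<otimes> h \<otimes> p \<otimes> s \<oplus> u \<otimes> (f \<otimes> b \<oplus> s \<otimes> (f \<otimes> z'))"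
        unfolding h using car f(1) by algebra
      also have "f \<otimes> b = s \<otimes> ((u \<otimes> b) \<otimes> y')" unfolding fs using car by algebra
      also have "u \<otimes> a \<otimes> h \<otimes> p \<otimes> s \<oplus> u \<otimes> (s \<otimes> ((u \<otimes> b) \<otimes> y') \<oplus> s \<otimes> (f \<otimes> z')) = s \<otimes> (u \<otimes> w)"
        unfolding w_def using car f(1) by algebra
      finally have "g \<otimes> h \<otimes> s [^] d' = u \<otimes> w"
        using s car wc by (simp add: m_lcancel p_def)
      moreover have "w \<in> poly_values M s d'"
        unfolding w_def
      proof (intro poly_values_add[OF M s(1)])
        have "p \<otimes> \<one> \<in> poly_values M s (d' + 0)"
          unfolding p_def using subringE(3)[OF M] by (intro poly_values_times_power[OF M s(1)]) simp
        then have "p \<in> poly_values M s d'" using car by simp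
        then show "(a \<otimes> h) \<otimes> p \<in> poly_values M s d'"
          using poly_values_smult[OF M s(1)] subringE(6)[OF M] a gM by blast
        show "f \<otimes> z' \<in> poly_values M s d'"
          using poly_values_smult[OF M s(1) f(2) z'] .
        show "(u \<otimes> b) \<otimes> y' \<in> poly_values M s d'"
          using poly_values_smult[OF M s(1) _ poly_values_mono[OF M s(1) le y']]
            subringE(6)[OF M] b gM by blast
      qed
      ultimately show False
        using less.hyps[of e d' g "g \<otimes> h" y w] less.prems gh ed by auto
    qed
  qed
qed

section \<open>Maximal choices of the subring and of the ring above it\<close>

lemma nat_pow_nonzero:
  assumes "u \<in> carrier R" "u \<noteq> \<zero>"
  shows "u [^] (n::nat) \<noteq> \<zero>"
  using assms by (induction n) (auto dest: integral)

text \<open>Over a maximal \<open>A\<close> no element is transcendental: by both claims of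
  \<open>separated_prime_adjoin\<close>, adjoining it would give something strictly larger in the
  order \<open>?le\<close>.\<close>

lemma exists_maximal_separated_prime:
  assumes good: "separated_prime u A0" and u0: "u \<noteq> \<zero>"
  shows "\<exists>A. separated_prime u A \<and> (\<forall>r\<in>carrier R. algebraic_elem A r)"
proof -
  let ?F = "{A. separated_prime u A}"
  txt \<open>Inclusion alone does not preserve \<open>\<Inter>n. u\<^sup>n A = 0\<close> along chains; the second clause,
    \<open>u B \<inter> A = u A\<close>, does.\<close>
  let ?le = "\<lambda>A B. A \<subseteq> B \<and> (\<forall>a\<in>A. \<forall>w\<in>B. a = u \<otimes> w \<longrightarrow> w \<in> A)"
  have "\<exists>A\<in>?F. \<forall>B\<in>?F. ?le A B \<longrightarrow> B = A"
  proof (rule predicate_Zorn)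
    show "partial_order_on ?F (relation_of ?le ?F)"
    proof (rule partial_order_on_relation_ofI)
      show "?le A D" if "?le A B" "?le B D" for A B D
        using that by (meson subset_trans subsetD)
    qed blast+
    fix C assume "C \<in> Chains (relation_of ?le ?F)"
    then have C: "\<And>A. A \<in> C \<Longrightarrow> separated_prime u A"
      and ch: "\<And>A B. A \<in> C \<Longrightarrow> B \<in> C \<Longrightarrow> ?le A B \<or> ?le B A"
      unfolding Chains_def relation_of_def by blast+
    show "\<exists>U\<in>?F. \<forall>A\<in>C. ?le A U"
    proof (cases "C = {}")
      case True
      then show ?thesis using good by auto
    next
      case False
      let ?U = "\<Union>C"
      have two: "\<exists>S\<in>C. x \<in> S \<and> y \<in> S" if "x \<in> ?U" "y \<in> ?U" for x y
      proof -
        obtain S T where "S \<in> C" "T \<in> C" "x \<in> S" "y \<in> T" using \<open>x \<in> ?U\<close> \<open>y \<in> ?U\<close> by blast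
        then show ?thesis using ch[of S T] by (meson subsetD)
      qed
      have le: "?le A ?U" if A: "A \<in> C" for A
      proof (intro conjI ballI impI)
        show "A \<subseteq> ?U" using A by auto
        fix a w assume a: "a \<in> A" "w \<in> ?U" "a = u \<otimes> w"
        then obtain B where "B \<in> C" "w \<in> B" by auto
        then show "w \<in> A" using ch[OF A, of B] a by blast
      qed
      have sub: "subring ?U R"
        using False separated_primeD(1)[OF C] ch by (intro Union_chain_subring) blast+
      have one: "\<one> \<notin> multiples ?U u"
        using C separated_primeD(3)[OF C] by (auto simp: multiples_def)
      have uc: "u \<in> carrier R" "u \<in> ?U"
        using False separated_primeD(2)[OF C] subringE(1)[OF sub] by blast+
      \<comment> \<open>\<open>?le\<close> lets a factor \<open>u\<close> be divided out without
        leaving \<open>A\<close>, so the induction descends from \<open>?U\<close> to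
        \<open>A\<close> one factor at a time. This is how primality and separatedness reach the
        union.\<close>
      have mult: "a \<in> multiples A (u [^] n)"
        if A: "A \<in> C" "a \<in> A" and "a \<in> multiples ?U (u [^] n)" for a A and n :: nat
        using that(2,3)
      proof (induction n arbitrary: a)
        case 0
        then have "a = u [^] (0::nat) \<otimes> a"
          using subringE(1)[OF separated_primeD(1)[OF C[OF A(1)]]] by auto
        then show ?case using 0(1) unfolding multiples_def by blast
      next
        case (Suc n)
        then obtain w where w: "w \<in> ?U" "a = u [^] Suc n \<otimes> w" by (auto simp: multiples_def)
        have wc: "w \<in> carrier R" using w subringE(1)[OF sub] by blast
        have eq: "a = u \<otimes> (u [^] n \<otimes> w)" using w wc uc by (simp add: m_ac)
        have up: "u [^] n \<in> ?U" by (induction n) (use subringE(3,6)[OF sub] uc in auto)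
        then have "u [^] n \<otimes> w \<in> A"
          using le[OF A(1)] Suc.prems(1) eq w subringE(6)[OF sub] by blast
        then have "u [^] n \<otimes> w \<in> multiples A (u [^] n)"
          using Suc.IH w by (auto simp: multiples_def)
        then obtain v where v: "v \<in> A" "u [^] n \<otimes> w = u [^] n \<otimes> v" by (auto simp: multiples_def)
        then have "w = v"
          using uc u0 wc subringE(1)[OF separated_primeD(1)[OF C[OF A(1)]]]
          by (metis m_lcancel nat_pow_closed nat_pow_nonzero subsetD)
        then show ?case using v w by (auto simp: multiples_def)
      qed
      have "separated_prime u ?U"
        unfolding separated_prime_def
      proof (intro conjI ballI impI)
        fix a b assume ab: "a \<in> ?U" "b \<in> ?U" "a \<otimes> b \<in> multiples ?U u"
        then obtain A where A: "A \<in> C" "a \<in> A" "b \<in> A" using two by blast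
        then have "a \<otimes> b \<in> A" using subringE(6)[OF separated_primeD(1)[OF C]] by blast
        then have "a \<otimes> b \<in> multiples A u"
          using mult[of A "a \<otimes> b" 1] A ab uc by simp
        then show "a \<in> multiples ?U u \<or> b \<in> multiples ?U u"
          using separated_primeD(4)[OF C[OF A(1)] A(2,3)] A(1) by (auto simp: multiples_def)
      next
        fix a assume a: "a \<in> ?U" "\<forall>n::nat. a \<in> multiples ?U (u [^] n)"
        then obtain A where "A \<in> C" "a \<in> A" by blast
        then show "a = \<zero>"
          using separated_primeD(5)[OF C, of A a] mult a by blast
      qed (use sub uc one in auto)
      then have "?U \<in> ?F" by simp
      moreover have "\<forall>A\<in>C. ?le A ?U" using le by (rule ballI)
      ultimately show ?thesis by (rule bexI[rotated])
    qed
  qed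
  then obtain A where "A \<in> ?F" and m: "\<forall>B\<in>?F. ?le A B \<longrightarrow> B = A" by (rule bexE)
  then have A: "separated_prime u A" by simp
  have max: "B = A" if "separated_prime u B" "?le A B" for B
    by (rule mp[OF bspec[OF m] that(2)]) (use that(1) in simp)
  note sub = separated_primeD(1)[OF A]
  have "algebraic_elem A r" if r: "r \<in> carrier R" for r
  proof (rule ccontr)
    assume na: "\<not> algebraic_elem A r"
    have "?le A (adjoin A r)"
      using adjoin_coeff[OF sub r] separated_prime_adjoin(2)[OF A u0 r na]
      by (intro conjI ballI impI subsetI)
    then have "adjoin A r = A"
      by (rule max[OF separated_prime_adjoin(1)[OF A u0 r na]])
    then show False
      using algebraic_member[OF sub] adjoin_generator[OF sub r] na by metis
  qed
  then show ?thesis using A by blast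
qed

text \<open>Let \<open>a = u^k h\<close> be the leading coefficient, with \<open>h\<close> outside
  \<open>u A\<close>. In terms of \<open>s = u^(k+1) r\<close> the leading term keeps the factor
  \<open>u^k\<close> while all lower terms carry \<open>u^(k+1)\<close>. Cancelling
  \<open>u^k\<close> leaves a relation of the second kind in
  \<open>no_opposite_relations\<close>.\<close>

lemma algebraic_scaled_relation:
  assumes good: "separated_prime u A" and u0: "u \<noteq> \<zero>" and r: "r \<in> carrier R"
    and alg: "algebraic_elem A r"
  shows "\<exists>(k::nat) (d::nat). \<exists>h\<in>A - multiples A u. \<exists>z\<in>poly_values A (u [^] k \<otimes> r) d.
           h \<otimes> (u [^] k \<otimes> r) [^] d = u \<otimes> z"
proof -
  note A = separated_primeD(1)[OF good] and uA = separated_primeD(2)[OF good]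
  obtain n a y where a: "a \<in> A" "a \<noteq> \<zero>" and y: "y \<in> poly_values A r n"
    and eq: "a \<otimes> r [^] Suc n \<oplus> y = \<zero>"
    using alg unfolding algebraic_elem_def by blast
  have uc: "u \<in> carrier R" using uA subringE(1)[OF A] by blast
  have upow: "u [^] k \<in> A" for k :: nat
    by (induction k) (use subringE(3,6)[OF A] uA in auto)
  have "\<exists>k::nat. a \<notin> multiples A (u [^] k)"
    using separated_primeD(5)[OF good a(1)] a(2) by blast
  \<comment> \<open>The least failing exponent \<open>m\<close> is positive because \<open>a\<close>
    is a multiple of \<open>u^0\<close>; its predecessor is the exact power of \<open>u\<close> in
    \<open>a\<close>.\<close>
  then obtain m :: nat where m: "a \<notin> multiples A (u [^] m)" "\<And>i. i < m \<Longrightarrow> a \<in> multiples A (u [^] i)"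
    unfolding exists_least_iff[of "\<lambda>m::nat. a \<notin> multiples A (u [^] m)"] by auto
  moreover have "a \<in> multiples A (u [^] (0::nat))"
    using a subringE(1)[OF A] by (force simp: multiples_def)
  ultimately obtain k where "m = Suc k" by (metis not0_implies_Suc)
  then have k: "a \<notin> multiples A (u [^] Suc k)" "a \<in> multiples A (u [^] k)"
    using m by auto
  obtain h where h: "h \<in> A" "a = u [^] k \<otimes> h" using k(2) by (auto simp: multiples_def)
  have hc: "h \<in> carrier R" "y \<in> carrier R"
    using h subringE(1)[OF A] poly_values_carrier[OF A r y] by auto
  have hu: "h \<notin> multiples A u"
  proof
    assume "h \<in> multiples A u"
    then obtain v where v: "v \<in> A" "h = u \<otimes> v" by (auto simp: multiples_def)
    moreover have "v \<in> carrier R" using v subringE(1)[OF A] by blast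
    ultimately have "a = u [^] Suc k \<otimes> v" using h uc by (simp add: m_assoc)
    then show False using k(1) v by (auto simp: multiples_def)
  qed
  define c where "c = u [^] Suc k"
  define s where "s = c \<otimes> r"
  define q where "q = c [^] n \<otimes> y"
  have c: "c \<in> A" "c \<in> carrier R" using upow uc unfolding c_def by blast+
  have q: "q \<in> poly_values A s n"
    unfolding q_def s_def by (rule poly_values_scale[OF A r c(1) y])
  have sc: "s \<in> carrier R" using c r by (simp add: s_def)
  have qc: "q \<in> carrier R" using poly_values_carrier[OF A sc q] .
  have "c [^] Suc n \<otimes> (a \<otimes> r [^] Suc n \<oplus> y) = u [^] k \<otimes> (h \<otimes> s [^] Suc n \<oplus> u \<otimes> q)"
  proof -
    have "s [^] Suc n = c [^] Suc n \<otimes> r [^] Suc n"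
      unfolding s_def using c r by (intro nat_pow_distrib)
    moreover define cn where "cn = c [^] Suc n"
    moreover define rn where "rn = r [^] Suc n"
    moreover define uk where "uk = u [^] k"
    moreover have "c [^] Suc n \<otimes> y = uk \<otimes> u \<otimes> q"
      using c hc uc unfolding q_def uk_def by (simp add: c_def m_ac)
    moreover have "cn \<in> carrier R" "rn \<in> carrier R" "uk \<in> carrier R"
      using c r uc by (auto simp: cn_def rn_def uk_def)
    ultimately show ?thesis
      using h hc uc qc by (simp add: r_distr m_ac)
  qed
  then have "u [^] k \<otimes> (h \<otimes> s [^] Suc n \<oplus> u \<otimes> q) = \<zero>" using eq c by simp
  then have "h \<otimes> s [^] Suc n \<oplus> u \<otimes> q = \<zero>"
    using integral[of "u [^] k"] nat_pow_nonzero[OF uc u0, of k] uc hc qc sc by auto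
  then have "h \<otimes> s [^] Suc n = u \<otimes> (\<ominus> q)"
    using uc hc qc sc by (metis m_closed minus_equality minus_minus nat_pow_closed r_minus a_comm)
  \<comment> \<open>The bound \<open>n\<close> is raised to \<open>Suc n\<close> because the
    conclusion uses one \<open>d\<close> both as exponent of \<open>s\<close> and as degree
    bound.\<close>
  moreover have "\<ominus> q \<in> poly_values A s (Suc n)"
  proof -
    have "\<ominus> \<one> \<otimes> q \<in> poly_values A s n"
      using poly_values_smult[OF A sc _ q] subringE(3,5)[OF A] by blast
    then show ?thesis using poly_values_Suc[OF A sc] qc by (simp only: l_minus one_closed l_one)
  qed
  ultimately show ?thesis
    using h(1) hu unfolding s_def c_def by blast
qed

text \<open>For \<open>M\<close> maximal subject to \<open>u M\<close> meeting \<open>A\<close> only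
  inside \<open>u A\<close>, the inverse of \<open>u\<close> is not in \<open>M\<close>, since
  \<open>\<one>\<close> is not in \<open>u A\<close>. The relation from
  \<open>algebraic_scaled_relation\<close> forces a multiple \<open>u^k r\<close> of every
  \<open>r\<close> into \<open>M\<close>, so inverting \<open>u\<close> yields the whole
  ring.\<close>

theorem submaximal_if_separated_prime_unit:
  assumes good0: "separated_prime u A0" and u: "u \<in> Units R"
  shows "submaximal R"
proof -
  have u0: "u \<noteq> \<zero>" 
  proof
    assume "u = \<zero>"
    then have "\<one> = \<zero> \<otimes> inv u" using Units_r_inv[OF u] by simp
    then show False using Units_inv_closed[OF u] one_not_zero by (metis l_null)
  qed
  obtain A where good: "separated_prime u A" and alg: "\<And>r. r \<in> carrier R \<Longrightarrow> algebraic_elem A r"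
    using exists_maximal_separated_prime[OF good0 u0] by blast
  note A = separated_primeD(1)[OF good] and uA = separated_primeD(2)[OF good]
  let ?F = "{M. subring M R \<and> A \<subseteq> M \<and> multiples M u \<inter> A \<subseteq> multiples A u}"
  have "\<exists>M\<in>?F. \<forall>Y\<in>?F. M \<subseteq> Y \<longrightarrow> Y = M"
  proof (rule subset_Zorn_nonempty)
    show "?F \<noteq> {}" using A by blast
    fix C assume C: "C \<noteq> {}" "subset.chain ?F C"
    then have "subring (\<Union>C) R"
      by (intro Union_chain_subring) (auto simp: subset_chain_def)
    moreover have "multiples M u \<inter> A \<subseteq> multiples A u" if "M \<in> C" for M
      using that C(2) unfolding subset_chain_def by blast
    then have "multiples (\<Union>C) u \<inter> A \<subseteq> multiples A u"
      unfolding multiples_def by blast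
    moreover have "A \<subseteq> \<Union>C" using C by (force simp: subset_chain_def)
    ultimately show "\<Union>C \<in> ?F" by simp
  qed
  then obtain M where M: "subring M R" "A \<subseteq> M" "multiples M u \<inter> A \<subseteq> multiples A u"
    and max: "\<And>Y. subring Y R \<Longrightarrow> A \<subseteq> Y \<Longrightarrow> multiples Y u \<inter> A \<subseteq> multiples A u \<Longrightarrow>
      M \<subseteq> Y \<Longrightarrow> Y = M"
    by auto
  show ?thesis
  proof (rule submaximal_if_power_absorbing[OF M(1) u])
    show "u \<in> M" using uA M(2) by blast
    show "inv u \<notin> M"
    proof
      assume "inv u \<in> M"
      then have "u \<otimes> inv u \<in> multiples M u" by (auto simp: multiples_def)
      then have "\<one> \<in> multiples M u" using u by simp
      then show False using M(3) subringE(3)[OF A] separated_primeD(3)[OF good] by blast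
    qed
    fix r assume r: "r \<in> carrier R"
    obtain k d :: nat and h z where h: "h \<in> A - multiples A u"
      and z: "z \<in> poly_values A (u [^] k \<otimes> r) d" and rel: "h \<otimes> (u [^] k \<otimes> r) [^] d = u \<otimes> z"
      using algebraic_scaled_relation[OF good u0 r alg[OF r]] by blast
    define s where "s = u [^] k \<otimes> r"
    have s: "s \<in> carrier R" using u r by (simp add: s_def Units_closed)
    have "s \<in> M"
    proof (cases "s = \<zero>")
      case True
      then show ?thesis using subringE(2)[OF M(1)] by simp
    next
      case False
      have mono: "poly_values A s n \<subseteq> poly_values M s n" for n
        using M(2) by (induction n) auto
      \<comment> \<open>A violation \<open>g = u y\<close> with \<open>y\<close> in
        \<open>adjoin M s\<close> would be opposite to \<open>rel\<close>. So
        \<open>adjoin M s\<close> satisfies the condition on \<open>M\<close>, and maximality puts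
        \<open>s\<close> into \<open>M\<close>.\<close>
      have "multiples (adjoin M s) u \<inter> A \<subseteq> multiples A u"
      proof
        fix g assume g: "g \<in> multiples (adjoin M s) u \<inter> A"
        then obtain e y where y: "y \<in> poly_values M s e" "g = u \<otimes> y"
          by (auto simp: multiples_def adjoin_def)
        show "g \<in> multiples A u"
        proof (rule ccontr)
          assume "g \<notin> multiples A u"
          then have g': "g \<in> A - multiples A u" using g by blast
          have z': "z \<in> poly_values M s d" using z mono unfolding s_def by blast
          show False
            by (rule no_opposite_relations[OF good M s False g' h y(1) z' y(2) rel[folded s_def]])
        qed
      qed
      then have "adjoin M s = M"
        using max[OF adjoin_subring[OF M(1) s]] adjoin_coeff[OF M(1) s] M(2) by blast
      then show ?thesis using adjoin_generator[OF M(1) s] by simp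
    qed
    then show "\<exists>n::nat. u [^] n \<otimes> r \<in> M" unfolding s_def by blast
  qed
qed

section \<open>Units of a domain of characteristic zero\<close>

text \<open>\<open>adjoin A u\<close> is a polynomial ring with variable \<open>u\<close>: modulo
  \<open>u\<close> it is the domain \<open>A\<close>, and a nonzero polynomial of degree at most
  \<open>n\<close> is not divisible by \<open>u^(n+1)\<close>.\<close>

lemma separated_prime_generator:
  assumes A: "subring A R" and u: "u \<in> carrier R" and na: "\<not> algebraic_elem A u"
  shows "separated_prime u (adjoin A u)"
proof -
  let ?B = "adjoin A u"
  have B: "subring ?B R" using adjoin_subring[OF A u] .
  have uB: "u \<in> ?B" using adjoin_generator[OF A u] .
  have AB: "a \<in> A \<Longrightarrow> a \<in> ?B" for a using adjoin_coeff[OF A u] by blast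
  have cA: "a \<in> A \<Longrightarrow> a \<in> carrier R" for a using subringE(1)[OF A] by blast
  have cB: "a \<in> ?B \<Longrightarrow> a \<in> carrier R" for a using subringE(1)[OF B] by blast
  have u0: "u \<noteq> \<zero>" using na algebraic_member[OF A] subringE(2)[OF A] by auto
  have const: "a = \<zero>" if a: "a \<in> A" "y \<in> ?B" "z \<in> ?B" "a \<oplus> u \<otimes> y = u \<otimes> z" for a y z
  proof -
    have c: "a \<in> carrier R" "y \<in> carrier R" "z \<in> carrier R" using a cA cB by auto
    have "a \<oplus> u \<otimes> (y \<ominus> z) = (a \<oplus> u \<otimes> y) \<ominus> u \<otimes> z"
      using c u by algebra
    also have "\<dots> = \<zero>" using a(4) c u by (simp add: minus_eq r_neg)
    finally have "a \<oplus> u \<otimes> (y \<ominus> z) = \<zero>" .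
    moreover have "y \<ominus> z \<in> ?B" using a subringE(5,7)[OF B] by (simp add: minus_eq)
    ultimately show ?thesis using nonalgebraic_const[OF A u na a(1)] by blast
  qed
  have one: "\<one> \<notin> multiples ?B u"
  proof
    assume "\<one> \<in> multiples ?B u"
    then obtain z where z: "z \<in> ?B" "\<one> = u \<otimes> z" by (auto simp: multiples_def)
    have "\<one> \<oplus> u \<otimes> \<zero> = u \<otimes> z" unfolding z(2)[symmetric] using u by simp
    then have "\<one> = \<zero>"
      using const[of \<one> \<zero> z] z(1) subringE(3)[OF A] subringE(2)[OF B] by blast
    then show False by simp
  qed
  have prime: "y \<in> multiples ?B u \<or> z \<in> multiples ?B u"
    if yz: "y \<in> ?B" "z \<in> ?B" "y \<otimes> z \<in> multiples ?B u" for y z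
  proof -
    obtain a y' where y: "a \<in> A" "y' \<in> ?B" "y = a \<oplus> u \<otimes> y'" using adjoin_cases[OF A u yz(1)] .
    obtain b z' where z: "b \<in> A" "z' \<in> ?B" "z = b \<oplus> u \<otimes> z'" using adjoin_cases[OF A u yz(2)] .
    obtain w where w: "w \<in> ?B" "y \<otimes> z = u \<otimes> w" using yz(3) by (auto simp: multiples_def)
    have c: "a \<in> carrier R" "y' \<in> carrier R" "b \<in> carrier R" "z' \<in> carrier R"
      using y(1,2) z(1,2) cA cB by auto
    have "a \<otimes> b \<oplus> u \<otimes> (a \<otimes> z' \<oplus> y' \<otimes> (b \<oplus> u \<otimes> z')) = y \<otimes> z"
      unfolding y(3) z(3) using c u by algebra
    then have "a \<otimes> b \<oplus> u \<otimes> (a \<otimes> z' \<oplus> y' \<otimes> z) = u \<otimes> w" using w(2) z(3) by simp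
    moreover have "a \<otimes> b \<in> A" using y z subringE(6)[OF A] by simp
    moreover have "a \<otimes> z' \<oplus> y' \<otimes> z \<in> ?B"
      using y(1,2) z(2) yz(2) AB subringE(6,7)[OF B] by simp
    ultimately have "a \<otimes> b = \<zero>" using const w(1) by blast
    then have "a = \<zero> \<or> b = \<zero>" using integral c by blast
    then show ?thesis
    proof
      assume "a = \<zero>"
      then have "y = u \<otimes> y'" using y c u by simp
      then show ?thesis using y(2) by (auto simp: multiples_def)
    next
      assume "b = \<zero>"
      then have "z = u \<otimes> z'" using z c u by simp
      then show ?thesis using z(2) by (auto simp: multiples_def)
    qed
  qed
  have "y \<in> poly_values A u n \<Longrightarrow> y \<in> multiples ?B (u [^] Suc n) \<Longrightarrow> y = \<zero>" for y n
  proof (induction n arbitrary: y)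
    case 0
    then obtain w where w: "w \<in> ?B" "y = u \<otimes> w" using u by (auto simp: multiples_def)
    have "y \<in> A" using 0 by simp
    moreover have "y \<oplus> u \<otimes> \<zero> = u \<otimes> w" using u cA[OF \<open>y \<in> A\<close>] w(2) by simp
    ultimately show ?case using const w(1) subringE(2)[OF B] by blast
  next
    case (Suc n)
    then obtain a y' where y: "a \<in> A" "y' \<in> poly_values A u n" "y = a \<oplus> u \<otimes> y'" by auto
    obtain w where w: "w \<in> ?B" "y = u [^] Suc (Suc n) \<otimes> w"
      using Suc.prems(2) by (auto simp: multiples_def)
    have y'B: "y' \<in> ?B" using y(2) by (auto simp: adjoin_def)
    have up: "u [^] k \<in> ?B" for k :: nat
      by (induction k) (use subringE(3,6)[OF B] uB in auto)
    have wc: "w \<in> carrier R" "y' \<in> carrier R" using cB w(1) y'B by auto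
    have yw: "y = u \<otimes> (u [^] Suc n \<otimes> w)" using w(2) wc u by (simp add: m_ac)
    then have a0: "a = \<zero>"
      using const[OF y(1) y'B, of "u [^] Suc n \<otimes> w"] y(3) subringE(6)[OF B up w(1)] by metis
    then have "u \<otimes> y' = u \<otimes> (u [^] Suc n \<otimes> w)" using y(3) yw u wc by simp
    then have "y' = u [^] Suc n \<otimes> w" using u u0 wc by (simp add: m_lcancel)
    then have "y' = \<zero>" using Suc.IH[OF y(2)] w(1) by (auto simp: multiples_def)
    then show ?case using a0 y(3) u by simp
  qed
  then have "y = \<zero>" if "y \<in> ?B" "\<And>n::nat. y \<in> multiples ?B (u [^] n)" for y
    using that unfolding adjoin_def by blast
  then show ?thesis
    unfolding separated_prime_def using B uB one prime by blast
qed

section \<open>The image of the integers\<close>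

definition of_integer :: "int \<Rightarrow> 'a" where
  "of_integer k = add_pow R k \<one>"

lemma of_integer_closed [simp]: "of_integer k \<in> carrier R"
  by (simp add: of_integer_def)

lemma of_integer_1 [simp]: "of_integer 1 = \<one>"
  by (simp add: of_integer_def)

lemma of_integer_add: "of_integer (k + l) = of_integer k \<oplus> of_integer l"
  using add.int_pow_mult[of \<one> k l] by (simp add: of_integer_def)

lemma of_integer_mult: "of_integer (k * l) = of_integer k \<otimes> of_integer l"
  using add_pow_ldistr_int[of \<one> "of_integer l" k] add.int_pow_pow[of \<one> k l]
  by (simp add: of_integer_def mult.commute)

lemma of_integer_uminus: "of_integer (- k) = \<ominus> of_integer k"
  using add.int_pow_neg[of \<one> k] by (simp add: of_integer_def)

lemma of_integer_power: "of_integer (k ^ n) = of_integer k [^] n"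
  by (induction n) (simp_all add: of_integer_mult m_comm)

lemma of_integer_nat: "of_integer (int n) = add_pow R n \<one>"
  by (simp add: of_integer_def add_pow_def int_pow_int)

lemma subring_integers: "subring (range of_integer) R"
proof (rule subringI)
  show "\<one> \<in> range of_integer" by (metis of_integer_1 rangeI)
qed (auto simp flip: of_integer_uminus of_integer_mult of_integer_add)

lemma of_integer_inj:
  assumes "char_zero R" and eq: "of_integer k = of_integer l"
  shows "k = l"
proof -
  have pos: False if "of_integer m = \<zero>" "m > 0" for m
  proof -
    have "add_pow R (nat m) \<one> = \<zero>" using that of_integer_nat[of "nat m"] by simp
    then show False using assms(1) that(2) by (auto simp: char_zero_def)
  qed
  \<comment> \<open>\<open>char_zero\<close> speaks of natural multiples only, so the difference is
    taken in both orders.\<close>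
  have "of_integer (k - l) = \<zero>" "of_integer (l - k) = \<zero>"
    using of_integer_add[of k "- l"] of_integer_add[of l "- k"] eq
    by (simp_all add: of_integer_uminus r_neg)
  then show ?thesis using pos[of "k - l"] pos[of "l - k"]
    by (cases k l rule: linorder_cases) auto
qed

text \<open>\<open>u\<close> is the variable of the polynomial ring that it generates over the
  integers, and yet a unit of the whole ring.\<close>

lemma submaximal_if_nonalgebraic_unit:
  assumes "u \<in> Units R" "\<not> algebraic_elem (range of_integer) u"
  shows "submaximal R"
  using submaximal_if_separated_prime_unit[OF separated_prime_generator[OF subring_integers _ assms(2)]]
    Units_closed assms(1) by blast

text \<open>In characteristic zero the image of the integers is a faithful copy, in which 2 is prime
  and only 0 is divisible by every power of 2.\<close>

lemma submaximal_if_two_unit: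
  assumes cz: "char_zero R" and two: "of_integer 2 \<in> Units R"
  shows "submaximal R"
proof (rule submaximal_if_separated_prime_unit[OF _ two])
  let ?Z = "range of_integer"
  have mult: "of_integer m \<in> multiples ?Z (of_integer k) \<longleftrightarrow> k dvd m" for k m
  proof
    assume "of_integer m \<in> multiples ?Z (of_integer k)"
    then obtain l where "of_integer m = of_integer (k * l)"
      by (auto simp: multiples_def of_integer_mult)
    then show "k dvd m" using of_integer_inj[OF cz] by (metis dvd_triv_left)
  next
    assume "k dvd m"
    then obtain l where "of_integer m = of_integer k \<otimes> of_integer l"
      by (auto simp: of_integer_mult)
    then show "of_integer m \<in> multiples ?Z (of_integer k)"
      unfolding multiples_def by blast
  qed
  have "m = 0" if "\<And>n::nat. 2 ^ n dvd m" for m :: int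
  proof (rule ccontr)
    assume "m \<noteq> 0"
    \<comment> \<open>The absolute value of \<open>m\<close> serves as exponent because
      \<open>2^k > k\<close>.\<close>
    then have "2 ^ nat \<bar>m\<bar> \<le> \<bar>m\<bar>" using that[of "nat \<bar>m\<bar>"] by (metis dvd_imp_le_int abs_numeral power_abs)
    moreover have "int (nat \<bar>m\<bar>) < int (2 ^ nat \<bar>m\<bar>)" by (simp only: of_nat_less_iff less_exp)
    ultimately show False by simp
  qed
  moreover have "of_integer 0 = \<zero>" by (simp add: of_integer_def add_pow_def)
  ultimately have "a = \<zero>" if "a \<in> ?Z" "\<And>n::nat. a \<in> multiples ?Z (of_integer 2 [^] n)" for a
    using that mult by (auto simp flip: of_integer_power)
  moreover have "\<one> \<notin> multiples ?Z (of_integer 2)"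
    using mult[of 1 2] by simp
  moreover have "a \<in> multiples ?Z (of_integer 2) \<or> b \<in> multiples ?Z (of_integer 2)"
    if "a \<in> ?Z" "b \<in> ?Z" "a \<otimes> b \<in> multiples ?Z (of_integer 2)" for a b
    using that mult by (auto simp flip: of_integer_mult)
  ultimately show "separated_prime (of_integer 2) ?Z"
    unfolding separated_prime_def using subring_integers by blast
qed

end

section \<open>Quotients and divisors\<close>

text \<open>An ideal maximal among those that contain \<open>I\<close> and miss \<open>S\<close> is
  prime: for \<open>a\<close> and \<open>b\<close> outside it, both enlarged ideals meet
  \<open>S\<close>, and if \<open>a b\<close> were inside, the product of the two elements found
  there would lie in the ideal and in \<open>S\<close>.\<close>

lemma (in cring) exists_prime_avoiding:
  assumes I: "ideal I R" and S: "S \<subseteq> carrier R" "\<one> \<in> S"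
    and mult: "\<And>s t. s \<in> S \<Longrightarrow> t \<in> S \<Longrightarrow> s \<otimes> t \<in> S" and disj: "I \<inter> S = {}"
  shows "\<exists>P. primeideal P R \<and> I \<subseteq> P \<and> P \<inter> S = {}"
proof -
  let ?F = "{J. ideal J R \<and> I \<subseteq> J \<and> J \<inter> S = {}}"
  have "\<exists>P\<in>?F. \<forall>J\<in>?F. P \<subseteq> J \<longrightarrow> J = P"
  proof (rule subset_Zorn_nonempty)
    show "?F \<noteq> {}" using I disj by blast
    fix C assume C: "C \<noteq> {}" "subset.chain ?F C"
    then have "subset.chain {J. ideal J R} C" by (auto simp: subset_chain_def)
    then have "ideal (\<Union>C) R" using chain_Union_is_ideal[of C] C(1) by simp
    moreover have "I \<subseteq> \<Union>C" using C by (force simp: subset_chain_def)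
    ultimately show "\<Union>C \<in> ?F" using C by (auto simp: subset_chain_def)
  qed
  then obtain P where P: "ideal P R" "I \<subseteq> P" "P \<inter> S = {}"
    and max: "\<And>J. ideal J R \<Longrightarrow> I \<subseteq> J \<Longrightarrow> J \<inter> S = {} \<Longrightarrow> P \<subseteq> J \<Longrightarrow> J = P"
    by auto
  interpret P: ideal P R by fact
  have ex: "\<exists>p\<in>P. \<exists>x\<in>carrier R. p \<oplus> x \<otimes> a \<in> S" if a: "a \<in> carrier R" "a \<notin> P" for a
  proof -
    let ?J = "P <+>\<^bsub>R\<^esub> PIdl a"
    have J: "ideal ?J R" using add_ideals[OF P(1) cgenideal_ideal[OF a(1)]] .
    have Jmem: "?J = {p \<oplus> x \<otimes> a | p x. p \<in> P \<and> x \<in> carrier R}"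
      by (auto simp: set_add_def' cgenideal_def)
    have "p \<in> ?J" if "p \<in> P" for p
    proof -
      have "p = p \<oplus> \<zero> \<otimes> a" using that a P.Icarr by simp
      then show ?thesis using that unfolding Jmem by blast
    qed
    then have sub: "P \<subseteq> ?J" by blast
    have "a = \<zero> \<oplus> \<one> \<otimes> a" using a by simp
    then have "a \<in> ?J" unfolding Jmem using P.zero_closed by blast
    then have "?J \<noteq> P" using a by blast
    then have "?J \<inter> S \<noteq> {}" using max[OF J] sub P(2) by blast
    then show ?thesis unfolding Jmem by blast
  qed
  have "primeideal P R"
  proof (rule primeidealI[OF P(1) is_cring])
    show "carrier R \<noteq> P" using P(3) S(2) by blast
    fix a b assume ab: "a \<in> carrier R" "b \<in> carrier R" "a \<otimes> b \<in> P"
    show "a \<in> P \<or> b \<in> P"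
    proof (rule ccontr)
      assume "\<not> (a \<in> P \<or> b \<in> P)"
      then obtain p x q y where
        p: "p \<in> P" "x \<in> carrier R" "p \<oplus> x \<otimes> a \<in> S" and q: "q \<in> P" "y \<in> carrier R" "q \<oplus> y \<otimes> b \<in> S"
        using ex ab by meson
      have c: "p \<in> carrier R" "q \<in> carrier R" using p q P.Icarr by auto
      have "(p \<oplus> x \<otimes> a) \<otimes> (q \<oplus> y \<otimes> b) =
              (q \<oplus> y \<otimes> b) \<otimes> p \<oplus> ((x \<otimes> a) \<otimes> q \<oplus> (x \<otimes> y) \<otimes> (a \<otimes> b))"
        using c p(2) q(2) ab(1,2) by algebra
      also have "\<dots> \<in> P"
        using P.I_l_closed[OF p(1), of "q \<oplus> y \<otimes> b"] P.I_l_closed[OF q(1), of "x \<otimes> a"]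
          P.I_l_closed[OF ab(3), of "x \<otimes> y"] c p(2) q(2) ab(1,2) by (intro P.a_closed) simp_all
      finally show False using mult[OF p(3) q(3)] P(3) by blast
    qed
  qed
  then show ?thesis using P by blast
qed

text \<open>The preimage of a maximal subring contains the kernel. A subring above it is then the
  full preimage of its image, so one strictly between would have an image strictly between.\<close>

lemma submaximal_lift:
  assumes "ring_hom_ring R S h" and surj: "h ` carrier R = carrier S" and "submaximal S"
  shows "submaximal R"
proof -
  interpret ring_hom_ring R S h by fact
  obtain T where T': "maximal_subring T S"
    using assms(3) unfolding submaximal_def by (rule exE)
  have T: "subring T S" "T \<subset> carrier S"
    using T' by (simp_all add: maximal_subring_def)
  have max: False if "subring U S" "T \<subset> U" "U \<subset> carrier S" for U
    using T' that unfolding maximal_subring_def by metis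
  let ?P = "{x \<in> carrier R. h x \<in> T}"
  have P: "subring ?P R"
    by (rule R.subringI) (use subringE[OF T(1)] in auto)
  have "maximal_subring ?P R"
    unfolding maximal_subring_def
  proof (intro conjI notI)
    show "subring ?P R" by fact
    have "\<exists>x\<in>carrier R. h x \<notin> T"
      using T(2) unfolding surj[symmetric] by blast
    then show "?P \<subset> carrier R" by blast
    assume "\<exists>U. subring U R \<and> ?P \<subset> U \<and> U \<subset> carrier R"
    then obtain U where U: "subring U R" "?P \<subset> U" "U \<subset> carrier R" by blast
    have hU: "subring (h ` U) S" using img_is_subring[OF U(1)] .
    have sat: "x \<in> U" if x: "x \<in> carrier R" "h x \<in> h ` U" for x
    proof -
      obtain y where y: "y \<in> U" "h x = h y" using x by blast
      have yc: "y \<in> carrier R" using y U(3) by blast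
      have "h (x \<ominus>\<^bsub>R\<^esub> y) = \<zero>\<^bsub>S\<^esub>" using x yc y(2) by (simp add: R.minus_eq S.r_neg)
      then have "x \<ominus>\<^bsub>R\<^esub> y \<in> ?P" using x yc subringE(2)[OF T(1)] by simp
      then have "(x \<ominus>\<^bsub>R\<^esub> y) \<oplus>\<^bsub>R\<^esub> y \<in> U" using U y subringE(7)[OF U(1)] by blast
      moreover have "(x \<ominus>\<^bsub>R\<^esub> y) \<oplus>\<^bsub>R\<^esub> y = x" using x yc by (simp add: R.minus_eq R.a_assoc R.l_neg)
      ultimately show ?thesis by simp
    qed
    have "T \<subseteq> h ` U"
    proof
      fix t assume t: "t \<in> T"
      then have "t \<in> h ` carrier R" using T(2) unfolding surj by blast
      then obtain x where "x \<in> carrier R" "t = h x" by blast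
      then show "t \<in> h ` U" using t U(2) by blast
    qed
    moreover have "T \<noteq> h ` U"
    proof
      assume "T = h ` U"
      then have "U \<subseteq> ?P" using U(3) by auto
      then show False using U(2) by blast
    qed
    moreover have "h ` U \<noteq> carrier S"
    proof
      assume "h ` U = carrier S"
      then have "x \<in> U" if "x \<in> carrier R" for x using sat[OF that] hom_closed[OF that] by simp
      then show False using U(3) by blast
    qed
    moreover have "h ` U \<subseteq> carrier S" using subringE(1)[OF hU] .
    ultimately show False using max[OF hU] by blast
  qed
  then show ?thesis unfolding submaximal_def by blast
qed

section \<open>Divisors of the integers\<close>

context domain
begin

text \<open>Modulo a prime ideal containing \<open>2x - 1\<close> the class of \<open>x\<close>
  inverts 2. No multiple of \<open>2x - 1\<close> is a positive integer, so the prime can be chosen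
  to avoid these, and the quotient keeps characteristic zero.\<close>

lemma submaximal_if_divides_no_integer:
  assumes x: "x \<in> carrier R"
    and avoid: "\<And>n::nat. n \<ge> 1 \<Longrightarrow> \<not> (of_integer 2 \<otimes> x \<ominus> \<one>) divides add_pow R n \<one>"
  shows "submaximal R"
proof -
  define y where "y = of_integer 2 \<otimes> x \<ominus> \<one>"
  have y: "y \<in> carrier R" using x by (simp add: y_def)
  let ?S = "{of_integer (int n) | n. n \<ge> 1}"
  have "\<exists>P. primeideal P R \<and> PIdl y \<subseteq> P \<and> P \<inter> ?S = {}"
  proof (rule exists_prime_avoiding)
    show "ideal (PIdl y) R" using cgenideal_ideal[OF y] .
    show "?S \<subseteq> carrier R" by auto
    show "\<one> \<in> ?S" using of_integer_1 by force
    show "s \<otimes> t \<in> ?S" if st: "s \<in> ?S" "t \<in> ?S" for s t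
    proof -
      obtain m n where mn: "s = of_integer (int m)" "t = of_integer (int n)" "m \<ge> 1" "n \<ge> 1"
        using st by blast
      then have "s \<otimes> t = of_integer (int (m * n))" by (simp add: of_integer_mult)
      moreover have "m * n \<ge> 1" using mn by simp
      ultimately show ?thesis by blast
    qed
    show "PIdl y \<inter> ?S = {}"
    proof (rule ccontr)
      assume "PIdl y \<inter> ?S \<noteq> {}"
      then obtain n where "of_integer (int n) \<in> PIdl y" "n \<ge> 1" by blast
      then obtain z where n: "n \<ge> 1" "z \<in> carrier R" "of_integer (int n) = z \<otimes> y"
        unfolding cgenideal_def by blast
      then have "y divides add_pow R n \<one>"
        unfolding factor_def of_integer_nat[symmetric] using m_comm[OF n(2) y] by metis
      then show False using avoid[OF n(1)] by (simp add: y_def)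
    qed
  qed
  then obtain P where P: "primeideal P R" "y \<in> P" "P \<inter> ?S = {}"
    using cgenideal_self[OF y] by blast
  interpret P: primeideal P R by fact
  interpret Q: domain "R Quot P" using P.quotient_is_domain .
  interpret h: ring_hom_ring R "R Quot P" "(+>) P" using P.rcos_ring_hom_ring .
  have surj: "(+>) P ` carrier R = carrier (R Quot P)"
    unfolding FactRing_def by (simp add: A_RCOSETS_def' UNION_singleton_eq_range)
  have hn: "P +> of_integer (int n) = Q.of_integer (int n)" for n
    unfolding of_integer_nat Q.of_integer_nat
    by (induction n) (simp_all add: add.nat_pow_Suc Q.add.nat_pow_Suc)
  have zero: "\<zero>\<^bsub>R Quot P\<^esub> = P" by (simp only: FactRing_def ring.simps)
  have "char_zero (R Quot P)"
    unfolding char_zero_def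
  proof (intro allI impI notI)
    fix n :: nat assume n: "n \<ge> 1" "add_pow (R Quot P) n \<one>\<^bsub>R Quot P\<^esub> = \<zero>\<^bsub>R Quot P\<^esub>"
    have "P +> of_integer (int n) = P" unfolding hn Q.of_integer_nat n(2) zero ..
    then have "of_integer (int n) \<in> P"
      using P.a_rcos_self[OF of_integer_closed, of "int n"] by metis
    then show False using P(3) n(1) by blast
  qed
  moreover have "Q.of_integer 2 \<in> Units (R Quot P)"
  proof -
    have Px: "P +> x \<in> carrier (R Quot P)" using h.hom_closed[OF x] .
    have "of_integer 2 \<otimes> x = y \<oplus> \<one>"
      unfolding y_def using x by (simp add: minus_eq a_assoc l_neg)
    then have "(P +> of_integer 2) \<otimes>\<^bsub>R Quot P\<^esub> (P +> x) = (P +> y) \<oplus>\<^bsub>R Quot P\<^esub> (P +> \<one>)"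
      using h.hom_mult[OF of_integer_closed x, of 2] h.hom_add[OF y one_closed] by metis
    also have "P +> y = \<zero>\<^bsub>R Quot P\<^esub>" unfolding zero by (rule P.a_rcos_const[OF P(2)])
    also have "P +> \<one> = \<one>\<^bsub>R Quot P\<^esub>" using h.hom_one .
    also have "P +> of_integer 2 = Q.of_integer 2" using hn[of 2] unfolding of_nat_numeral .
    also have "\<zero>\<^bsub>R Quot P\<^esub> \<oplus>\<^bsub>R Quot P\<^esub> \<one>\<^bsub>R Quot P\<^esub> = \<one>\<^bsub>R Quot P\<^esub>"
      by (rule Q.l_zero[OF Q.one_closed])
    finally have "Q.of_integer 2 \<otimes>\<^bsub>R Quot P\<^esub> (P +> x) = \<one>\<^bsub>R Quot P\<^esub>" .
    moreover from this have "(P +> x) \<otimes>\<^bsub>R Quot P\<^esub> Q.of_integer 2 = \<one>\<^bsub>R Quot P\<^esub>"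
      using Q.m_comm[OF Px Q.of_integer_closed] by (rule trans[rotated])
    ultimately show ?thesis
      unfolding Units_def using Px Q.of_integer_closed by blast
  qed
  ultimately show ?thesis
    using submaximal_lift[OF h.ring_hom_ring_axioms surj] Q.submaximal_if_two_unit by blast
qed

text \<open>A divisor of \<open>a\<close> is a unit or, up to a unit, a product of irreducible
  divisors of \<open>a\<close>; classes of associates are countable because the units are.
  Factorization enters as the hypothesis \<open>fact\<close>, so that atomic and noetherian domains
  are treated alike.\<close>

lemma countable_divisors:
  assumes U: "countable (Units R)" and a: "a \<in> carrier R" "a \<noteq> \<zero>"
    and fact: "\<And>b. b \<in> carrier R \<Longrightarrow> b \<noteq> \<zero> \<Longrightarrow> b \<notin> Units R \<Longrightarrow>
      \<exists>fs. set fs \<subseteq> carrier (mult_of R) \<and> wfactors (mult_of R) fs b"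
    and irr: "countably_many_irreducible_divisors R a"
  shows "countable {b \<in> carrier R. b divides a}"
proof -
  let ?D = "irreducible_divisors R a"
  have "countable ?D"
  proof -
    have "?D \<subseteq> (\<Union>c\<in>assocs R ` ?D. {p \<in> ?D. assocs R p = c})" by blast
    moreover have "countable {p \<in> ?D. assocs R p = c}" if c: "c \<in> assocs R ` ?D" for c
    proof -
      obtain q where q: "q \<in> ?D" "c = assocs R q" using c by blast
      have "{p \<in> ?D. assocs R p = c} \<subseteq> (\<lambda>u. u \<otimes> q) ` Units R"
      proof
        fix p assume p: "p \<in> {p \<in> ?D. assocs R p = c}"
        then have "p \<in> carrier R" "q \<in> carrier R" "p \<in> assocs R q"
          using q assocs_repr_independenceD[of q p] by (auto simp: irreducible_divisors_def)
        then have "\<exists>u\<in>Units R. p = u \<otimes> q"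
          using assocs_assoc[of p q] ring_associated_iff[of p q] by simp
        then show "p \<in> (\<lambda>u. u \<otimes> q) ` Units R" by blast
      qed
      then show ?thesis by (rule countable_subset[OF _ countable_image[OF U]])
    qed
    ultimately show ?thesis
      using irr unfolding countably_many_irreducible_divisors_def
      by (meson countable_UN countable_subset)
  qed
  have "{b \<in> carrier R. b divides a} \<subseteq>
          Units R \<union> (\<lambda>(u, fs). u \<otimes> foldr (\<otimes>) fs \<one>) ` (Units R \<times> lists ?D)"
  proof
    fix b assume "b \<in> {b \<in> carrier R. b divides a}"
    then have b: "b \<in> carrier R" "b divides a" by auto
    have b0: "b \<noteq> \<zero>" using b a by (auto simp: factor_def)
    show "b \<in> Units R \<union> (\<lambda>(u, fs). u \<otimes> foldr (\<otimes>) fs \<one>) ` (Units R \<times> lists ?D)"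
    proof (cases "b \<in> Units R")
      case False
      then obtain fs where fs: "set fs \<subseteq> carrier (mult_of R)" "wfactors (mult_of R) fs b"
        using fact b(1) b0 by blast
      have "f \<in> ?D" if f: "f \<in> set fs" for f
      proof -
        have fc: "f \<in> carrier R - {\<zero>}" using f fs(1) by auto
        have "irreducible (mult_of R) f" using f fs(2) by (auto simp: wfactors_def)
        then have "ring_irreducible f" using ring_irreducibleI' fc by blast
        \<comment> \<open>Factorizations live in \<open>mult_of R\<close>, whereas \<open>?D\<close>
          refers to divisibility in \<open>R\<close>.\<close>
        moreover have "f divides\<^bsub>mult_of R\<^esub> b"
          using mult_of.wfactors_dividesI[OF fs(2,1)] f b(1) b0 by simp
        then have "f divides a" using b(2) divides_trans fc by (meson DiffD1 divides_mult_imp_divides)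
        ultimately show ?thesis using fc by (simp add: irreducible_divisors_def)
      qed
      then have "fs \<in> lists ?D" by blast
      moreover have "set fs \<subseteq> carrier R" using fs(1) by auto
      then have prod: "foldr (\<otimes>) fs \<one> \<in> carrier R" by (induction fs) auto
      have "b \<sim>\<^bsub>mult_of R\<^esub> foldr (\<otimes>) fs \<one>"
        using fs(2) by (auto simp: wfactors_def associated_def)
      then have "b \<sim> foldr (\<otimes>) fs \<one>" using assoc_iff_assoc_mult[OF b(1) prod] by simp
      then obtain u where "u \<in> Units R" "b = u \<otimes> foldr (\<otimes>) fs \<one>"
        using ring_associated_iff[OF b(1) prod] by blast
      ultimately show ?thesis by force
    qed simp
  qed
  moreover have "countable (Units R \<union> (\<lambda>(u, fs). u \<otimes> foldr (\<otimes>) fs \<one>) ` (Units R \<times> lists ?D))"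
    using U \<open>countable ?D\<close> by (intro countable_Un countable_image countable_SIGMA countable_lists)
  ultimately show ?thesis by (rule countable_subset)
qed

end

section \<open>The counting argument\<close>

theorem theorem2p5:
  fixes R :: "('a, 'b) ring_scheme"
  assumes "domain R"
    and "uncountable (carrier R)"
    and "atomic_domain R \<or> noetherian_ring R"
    and "char_zero R"
    and "\<And>n::nat. n \<ge> 1 \<Longrightarrow> countably_many_irreducible_divisors R ([n] \<cdot>\<^bsub>R\<^esub> \<one>\<^bsub>R\<^esub>)"
  shows "submaximal R"
proof (rule ccontr)
  assume not: "\<not> submaximal R"
  interpret domain R by fact
  \<comment> \<open>\<open>wfactors\<close>, a product up to associates, is the form that both
    alternatives deliver.\<close>
  have fact: "\<exists>fs. set fs \<subseteq> carrier (mult_of R) \<and> wfactors (mult_of R) fs b"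
    if b: "b \<in> carrier R" "b \<noteq> \<zero>\<^bsub>R\<^esub>" "b \<notin> Units R" for b
    using assms(3)
  proof
    assume "atomic_domain R"
    then show ?thesis
      using b mult_of.factors_wfactors unfolding atomic_domain_def by blast
  next
    assume "noetherian_ring R"
    then interpret noetherian_domain R
      by (intro noetherian_domain.intro domain_axioms)
    show ?thesis using factorization_property b by simp
  qed
  let ?Z = "range of_integer"
  \<comment> \<open>A unit transcendental over the integers would already make the ring submaximal;
    only countably many elements are algebraic.\<close>
  have "Units R \<subseteq> {r \<in> carrier R. algebraic_elem ?Z r}"
    using not submaximal_if_nonalgebraic_unit Units_closed by blast
  then have U: "countable (Units R)"
    using countable_algebraic[OF subring_integers] by (auto intro: countable_subset)
  let ?D = "\<Union>n\<in>{1..}. {b \<in> carrier R. b divides\<^bsub>R\<^esub> add_pow R (n::nat) \<one>\<^bsub>R\<^esub>}"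
  have D: "countable ?D"
  proof (intro countable_UN)
    fix n :: nat assume n: "n \<in> {1..}"
    show "countable {b \<in> carrier R. b divides\<^bsub>R\<^esub> add_pow R n \<one>\<^bsub>R\<^esub>}"
    proof (rule countable_divisors[OF U _ _ fact])
      show "add_pow R n \<one>\<^bsub>R\<^esub> \<in> carrier R" by simp
      show "add_pow R n \<one>\<^bsub>R\<^esub> \<noteq> \<zero>\<^bsub>R\<^esub>" using assms(4) n by (simp add: char_zero_def)
      show "countably_many_irreducible_divisors R (add_pow R n \<one>\<^bsub>R\<^esub>)" using assms(5) n by simp
    qed
  qed simp
  \<comment> \<open>Injectivity, from 2 being nonzero in a domain, gives uncountably many values, so
    one of them escapes the countable set \<open>?D\<close>.\<close>
  define f where "f = (\<lambda>x. of_integer 2 \<otimes>\<^bsub>R\<^esub> x \<ominus>\<^bsub>R\<^esub> \<one>\<^bsub>R\<^esub>)"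
  have "inj_on f (carrier R)"
  proof (rule inj_onI)
    fix x y assume xy: "x \<in> carrier R" "y \<in> carrier R" "f x = f y"
    then have "of_integer 2 \<otimes>\<^bsub>R\<^esub> x = of_integer 2 \<otimes>\<^bsub>R\<^esub> y" by (simp add: f_def minus_eq)
    moreover have "of_integer 2 \<noteq> \<zero>\<^bsub>R\<^esub>"
      using assms(4) of_integer_nat[of 2] by (simp add: char_zero_def)
    ultimately show "x = y" using xy by (simp add: m_lcancel)
  qed
  then have "uncountable (f ` carrier R)"
    using assms(2) countable_image_inj_on by blast
  then have "\<not> f ` carrier R \<subseteq> ?D" using D countable_subset by blast
  then obtain x where x: "x \<in> carrier R" "f x \<notin> ?D" by blast
  then have "f x \<in> carrier R" by (simp add: f_def)
  then have "\<not> f x divides\<^bsub>R\<^esub> add_pow R n \<one>\<^bsub>R\<^esub>" if "n \<ge> 1" for n :: nat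
    using x that by auto
  then show False using not submaximal_if_divides_no_integer[OF x(1)] unfolding f_def by blast
qed

end
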